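(* Let $k$ be a field, $R=k[x_1,\ldots,x_d]$ the standard graded polynomial ring, $I\subseteq R$ a square-free monomial ideal, and $n,m\in\mathbb Z_{>0}$. Then: (1) $\operatorname{depth}(R/I^{(n)})\leq \operatorname{depth}\big(R/I^{(\lceil n/m\rceil)}\big)$. (2) $a_i(R/I^{(n)})\geq m\, a_i\big(R/I^{(\lceil n/m\rceil)}\big)$ for every $0\leq i\leq\dim R/I$.
   Context: Let $\mathfrak m=(x_1,\ldots,x_d)$; depth is taken with respect to $\mathfrak m$. For $n\in\mathbb Z_{>0}$, the $n$-th symbolic power of $I$ is $I^{(n)}=\bigcap_{\mathfrak p\in \operatorname{Min}(R/I)} (I^nR_{\mathfrak p}\cap R)$, where $\operatorname{Min}(R/I)$ is the set of minimal primes of $I$. For a finitely generated graded $R$-module $M$ and $0\leq i\leq\dim M$, the $i$-th $a$-invariant is $a_i(M)=\max\{j\mid H^i_{\mathfrak m}(M)_j\neq 0\}$, with the convention $a_i(M)=-\infty$ if $H^i_{\mathfrak m}(M)=0$, where $H^i_{\mathfrak m}$ denotes local cohomology (and $m\cdot(-\infty)=-\infty$). *)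

theory Defs
  imports
    "HOL-Algebra.Algebra"
    "HOL-Algebra.Algebraic_Closure_Type"
    "HOL-Library.Poly_Mapping"
    "HOL-Library.Extended_Real"
    "HOL-Library.Extended_Nat"
begin

section \<open>Localization of modules\<close>

text \<open>
  The fraction \<open>u/s\<close>, for \<open>u \<in> M\<close> and \<open>s\<close> in the multiplicative set \<open>W\<close>, is the equivalence
  class of \<open>(u, s)\<close>. The operations below take unions over representatives, all of which
  contribute one and the same class.
\<close>

definition fraction_rel ::
  "('r, 'a) ring_scheme \<Rightarrow> ('r, 'm, 'b) module_scheme \<Rightarrow> 'r set \<Rightarrow> (('m \<times> 'r) \<times> ('m \<times> 'r)) set" where
  "fraction_rel R M W =
     {((u, s), (v, t)). u \<in> carrier M \<and> s \<in> W \<and> v \<in> carrier M \<and> t \<in> W \<and>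
        (\<exists>w\<in>W. (w \<otimes>\<^bsub>R\<^esub> t) \<odot>\<^bsub>M\<^esub> u = (w \<otimes>\<^bsub>R\<^esub> s) \<odot>\<^bsub>M\<^esub> v)}"

definition fraction ::
  "('r, 'a) ring_scheme \<Rightarrow> ('r, 'm, 'b) module_scheme \<Rightarrow> 'r set \<Rightarrow> 'm \<Rightarrow> 'r \<Rightarrow> ('m \<times> 'r) set" where
  "fraction R M W u s = fraction_rel R M W `` {(u, s)}"

text \<open>
  Modules are records extending rings; the fields \<^const>\<open>monoid.mult\<close> and \<^const>\<open>monoid.one\<close> of
  such a record play no role for the module structure and are left unspecified here.
\<close>

definition localization ::
  "('r, 'a) ring_scheme \<Rightarrow> ('r, 'm, 'b) module_scheme \<Rightarrow> 'r set \<Rightarrow> ('r, ('m \<times> 'r) set) module" where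
  "localization R M W =
     \<lparr>carrier = {fraction R M W u s | u s. u \<in> carrier M \<and> s \<in> W},
      monoid.mult = undefined, one = undefined,
      ring.zero = fraction R M W \<zero>\<^bsub>M\<^esub> \<one>\<^bsub>R\<^esub>,
      add = (\<lambda>A B. \<Union>p\<in>A. \<Union>q\<in>B. case (p, q) of ((u, s), (v, t)) \<Rightarrow>
               fraction R M W (t \<odot>\<^bsub>M\<^esub> u \<oplus>\<^bsub>M\<^esub> s \<odot>\<^bsub>M\<^esub> v) (s \<otimes>\<^bsub>R\<^esub> t)),
      module.smult = (\<lambda>r A. \<Union>p\<in>A. case p of (u, s) \<Rightarrow> fraction R M W (r \<odot>\<^bsub>M\<^esub> u) s)\<rparr>"

text \<open>The canonical map from a localization of \<open>M\<close> to its localization at a larger set \<open>W\<close>.\<close>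

definition localization_map ::
  "('r, 'a) ring_scheme \<Rightarrow> ('r, 'm, 'b) module_scheme \<Rightarrow> 'r set \<Rightarrow> ('m \<times> 'r) set \<Rightarrow> ('m \<times> 'r) set" where
  "localization_map R M W A = (\<Union>p\<in>A. case p of (u, s) \<Rightarrow> fraction R M W u s)"

text \<open>
  The degree \<open>j\<close> part of a localization of a graded module: \<open>u/s\<close> with \<open>u\<close>, \<open>s\<close> homogeneous and
  \<open>deg u - deg s = j\<close>.
\<close>

definition localization_graded ::
  "('r, 'a) ring_scheme \<Rightarrow> (int \<Rightarrow> 'r set) \<Rightarrow> ('r, 'm, 'b) module_scheme \<Rightarrow> (int \<Rightarrow> 'm set) \<Rightarrow>
     'r set \<Rightarrow> int \<Rightarrow> ('m \<times> 'r) set set" where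
  "localization_graded R gR M gM W j =
     {fraction R M W u s | u s e. s \<in> W \<inter> gR e \<and> u \<in> gM (j + e)}"


section \<open>Quotient modules, dimension, depth\<close>

definition self_module :: "('r, 'a) ring_scheme \<Rightarrow> ('r, 'r) module" where
  "self_module R =
     \<lparr>carrier = carrier R, monoid.mult = monoid.mult R, one = \<one>\<^bsub>R\<^esub>,
      ring.zero = \<zero>\<^bsub>R\<^esub>, add = add R, module.smult = monoid.mult R\<rparr>"

definition quot_module :: "('r, 'a) ring_scheme \<Rightarrow> 'r set \<Rightarrow> ('r, 'r set) module" where
  "quot_module R J =
     \<lparr>carrier = carrier (R Quot J), monoid.mult = monoid.mult (R Quot J), one = \<one>\<^bsub>R Quot J\<^esub>,
      ring.zero = \<zero>\<^bsub>R Quot J\<^esub>, add = add (R Quot J),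
      module.smult = (\<lambda>r A. (J +>\<^bsub>R\<^esub> r) \<otimes>\<^bsub>R Quot J\<^esub> A)\<rparr>"

text \<open>Krull dimension; the zero ring has no prime ideals and thus dimension \<open>-\<infinity>\<close>.\<close>

definition krull_dim :: "('r, 'a) ring_scheme \<Rightarrow> ereal" where
  "krull_dim R =
     Sup {ereal (real n) | n. \<exists>P :: nat \<Rightarrow> 'r set.
            (\<forall>k\<le>n. primeideal (P k) R) \<and> (\<forall>k<n. P k \<subset> P (Suc k))}"

text \<open>\<open>(f\<^sub>1, \<dots>, f\<^sub>r) M\<close>\<close>

definition seq_submodule :: "('r, 'm, 'b) module_scheme \<Rightarrow> 'r list \<Rightarrow> 'm set" where
  "seq_submodule M fs =
     {(\<Oplus>\<^bsub>M\<^esub>k\<in>{..<length fs}. fs ! k \<odot>\<^bsub>M\<^esub> u k) | u. u \<in> {..<length fs} \<rightarrow> carrier M}"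

definition regular_sequence :: "('r, 'm, 'b) module_scheme \<Rightarrow> 'r list \<Rightarrow> bool" where
  "regular_sequence M fs \<longleftrightarrow>
     (\<forall>k<length fs. \<forall>u\<in>carrier M.
        fs ! k \<odot>\<^bsub>M\<^esub> u \<in> seq_submodule M (take k fs) \<longrightarrow> u \<in> seq_submodule M (take k fs)) \<and>
     seq_submodule M fs \<noteq> carrier M"

text \<open>Depth with respect to an ideal \<open>\<aa>\<close>; as usual, the zero module has depth \<open>\<infinity>\<close>.\<close>

definition depth :: "'r set \<Rightarrow> ('r, 'm, 'b) module_scheme \<Rightarrow> enat" where
  "depth \<aa> M =
     (if carrier M = {\<zero>\<^bsub>M\<^esub>} then \<infinity>
      else Sup {enat (length fs) | fs. set fs \<subseteq> \<aa> \<and> regular_sequence M fs})"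


section \<open>Symbolic powers\<close>

definition minimal_primes :: "('r, 'a) ring_scheme \<Rightarrow> 'r set \<Rightarrow> 'r set set" where
  "minimal_primes R I =
     {P. primeideal P R \<and> I \<subseteq> P \<and> (\<forall>Q. primeideal Q R \<and> I \<subseteq> Q \<and> Q \<subseteq> P \<longrightarrow> Q = P)}"

text \<open>
  \<open>J R\<^sub>P \<inter> R\<close>, that is, the preimage under \<open>R \<rightarrow> R\<^sub>P\<close> of the extended ideal
  \<open>J R\<^sub>P = {a/s. a \<in> J, s \<notin> P}\<close>.
\<close>

definition local_contraction :: "('r, 'a) ring_scheme \<Rightarrow> 'r set \<Rightarrow> 'r set \<Rightarrow> 'r set" where
  "local_contraction R P J =
     (let W = carrier R - P in
      {r \<in> carrier R. fraction R (self_module R) W r \<one>\<^bsub>R\<^esub> \<in>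
         {fraction R (self_module R) W a s | a s. a \<in> J \<and> s \<in> W}})"

definition symbolic_power :: "('r, 'a) ring_scheme \<Rightarrow> 'r set \<Rightarrow> nat \<Rightarrow> 'r set" where
  "symbolic_power R I n =
     carrier R \<inter> (\<Inter>P\<in>minimal_primes R I. local_contraction R P (I [^]\<^bsub>ideals_set R\<^esub> n))"


section \<open>The standard graded polynomial ring\<close>

text \<open>
  The variables are indexed by a finite, linearly ordered type \<open>'x\<close>, so that \<open>d\<close> is \<open>CARD('x)\<close>.
  The order only enters the signs in the Cech complex.
\<close>

type_synonym ('x, 'k) mpoly = "('x \<Rightarrow>\<^sub>0 nat) \<Rightarrow>\<^sub>0 'k"

abbreviation mpoly_ring :: "('x::{finite,linorder}, 'k::field) mpoly ring" where
  "mpoly_ring \<equiv> ring_of_type_algebra"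

definition monomial :: "('x \<Rightarrow>\<^sub>0 nat) \<Rightarrow> ('x::{finite,linorder}, 'k::field) mpoly" where
  "monomial a = Poly_Mapping.single a 1"

definition irrelevant_ideal :: "('x::{finite,linorder}, 'k::field) mpoly set" where
  "irrelevant_ideal = Idl\<^bsub>mpoly_ring\<^esub> (range (\<lambda>x. monomial (Poly_Mapping.single x 1)))"

definition squarefree_monomial_ideal :: "('x::{finite,linorder}, 'k::field) mpoly set \<Rightarrow> bool" where
  "squarefree_monomial_ideal I \<longleftrightarrow>
     (\<exists>A. (\<forall>a\<in>A. \<forall>x. Poly_Mapping.lookup a x \<le> 1) \<and> I = Idl\<^bsub>mpoly_ring\<^esub> (monomial ` A))"

definition poly_graded :: "int \<Rightarrow> ('x::{finite,linorder}, 'k::field) mpoly set" where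
  "poly_graded j = {f. \<forall>a\<in>Poly_Mapping.keys f. int (\<Sum>x\<in>UNIV. Poly_Mapping.lookup a x) = j}"

definition quot_graded ::
  "('x::{finite,linorder}, 'k::field) mpoly set \<Rightarrow> int \<Rightarrow> ('x, 'k) mpoly set set" where
  "quot_graded J j = (\<lambda>f. J +>\<^bsub>mpoly_ring\<^esub> f) ` poly_graded j"


section \<open>Local cohomology and a-invariants\<close>

text \<open>
  Local cohomology with support in \<open>\<mm> = (x\<^sub>1, \<dots>, x\<^sub>d)\<close> is the cohomology of the Cech complex on
  \<open>x\<^sub>1, \<dots>, x\<^sub>d\<close>, whose \<open>i\<close>-th term is the product of the \<open>M\<^bsub>x_F\<^esub>\<close> over all \<open>F\<close> with \<open>i\<close> elements, where
  \<open>x_F\<close> is the product of the variables in \<open>F\<close>. The module \<open>M\<^bsub>x_F\<^esub>\<close> is realized by inverting all monomials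
  in the variables from \<open>F\<close>, so that for \<open>F \<subseteq> G\<close> the denominators are nested. Groups such as the
  terms of the complex are written multiplicatively.
\<close>

definition cech_denoms :: "'x set \<Rightarrow> ('x::{finite,linorder}, 'k::field) mpoly set" where
  "cech_denoms F = {monomial a | a. Poly_Mapping.keys a \<subseteq> F}"

definition cech_local ::
  "(('x::{finite,linorder}, 'k::field) mpoly, 'm, 'b) module_scheme \<Rightarrow> 'x set \<Rightarrow>
     (('x, 'k) mpoly, ('m \<times> ('x, 'k) mpoly) set) module" where
  "cech_local M F = localization mpoly_ring M (cech_denoms F)"

definition cech_term ::
  "(('x::{finite,linorder}, 'k::field) mpoly, 'm, 'b) module_scheme \<Rightarrow> nat \<Rightarrow>
     ('x set \<Rightarrow> ('m \<times> ('x, 'k) mpoly) set) monoid" where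
  "cech_term M i = product_group {F. card F = i} (\<lambda>F. add_monoid (cech_local M F))"

definition cech_diff ::
  "(('x::{finite,linorder}, 'k::field) mpoly, 'm, 'b) module_scheme \<Rightarrow> nat \<Rightarrow>
     ('x set \<Rightarrow> ('m \<times> ('x, 'k) mpoly) set) \<Rightarrow> 'x set \<Rightarrow> ('m \<times> ('x, 'k) mpoly) set" where
  "cech_diff M i c =
     (\<lambda>F\<in>{F. card F = Suc i}.
        \<Oplus>\<^bsub>cech_local M F\<^esub>x\<in>F.
          (let y = localization_map mpoly_ring M (cech_denoms F) (c (F - {x}))
           in if even (card {z\<in>F. z < x}) then y else \<ominus>\<^bsub>cech_local M F\<^esub> y))"

definition cech_cocycles ::
  "(('x::{finite,linorder}, 'k::field) mpoly, 'm, 'b) module_scheme \<Rightarrow> nat \<Rightarrow>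
     ('x set \<Rightarrow> ('m \<times> ('x, 'k) mpoly) set) set" where
  "cech_cocycles M i = kernel (cech_term M i) (cech_term M (Suc i)) (cech_diff M i)"

definition cech_coboundaries ::
  "(('x::{finite,linorder}, 'k::field) mpoly, 'm, 'b) module_scheme \<Rightarrow> nat \<Rightarrow>
     ('x set \<Rightarrow> ('m \<times> ('x, 'k) mpoly) set) set" where
  "cech_coboundaries M i =
     (case i of 0 \<Rightarrow> {\<one>\<^bsub>cech_term M 0\<^esub>} | Suc l \<Rightarrow> cech_diff M l ` carrier (cech_term M l))"

definition local_cohomology ::
  "(('x::{finite,linorder}, 'k::field) mpoly, 'm, 'b) module_scheme \<Rightarrow> nat \<Rightarrow>
     ('x set \<Rightarrow> ('m \<times> ('x, 'k) mpoly) set) set monoid" where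
  "local_cohomology M i =
     (cech_term M i)\<lparr>carrier := cech_cocycles M i\<rparr> Mod cech_coboundaries M i"

text \<open>
  For a grading \<open>gM\<close> of \<open>M\<close>, the degree \<open>j\<close> part of local cohomology consists of the classes of the
  cocycles whose components are all of degree \<open>j\<close>.
\<close>

definition local_cohomology_graded ::
  "(('x::{finite,linorder}, 'k::field) mpoly, 'm, 'b) module_scheme \<Rightarrow> (int \<Rightarrow> 'm set) \<Rightarrow> nat \<Rightarrow> int \<Rightarrow>
     ('x set \<Rightarrow> ('m \<times> ('x, 'k) mpoly) set) set set" where
  "local_cohomology_graded M gM i j =
     {cech_coboundaries M i #>\<^bsub>cech_term M i\<^esub> c | c. c \<in> cech_cocycles M i \<and>
        (\<forall>F. card F = i \<longrightarrow> c F \<in> localization_graded mpoly_ring poly_graded M gM (cech_denoms F) j)}"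

text \<open>
  For finitely generated \<open>M\<close> the set of degrees is bounded above, so the supremum is \<open>-\<infinity>\<close> if the
  local cohomology vanishes and a maximum otherwise.
\<close>

definition a_invariant ::
  "(('x::{finite,linorder}, 'k::field) mpoly, 'm, 'b) module_scheme \<Rightarrow> (int \<Rightarrow> 'm set) \<Rightarrow> nat \<Rightarrow> ereal" where
  "a_invariant M gM i =
     Sup {ereal (real_of_int j) | j.
            local_cohomology_graded M gM i j \<noteq> {\<one>\<^bsub>local_cohomology M i\<^esub>}}"

end

theory Submission
  imports Defs
begin

text \<open>
  For a squarefree monomial ideal, \<open>I\<^sup>(\<^sup>n\<^sup>)\<close> is the intersection of the \<open>n\<close>-th powers of the monomial primes
  minimal over \<open>I\<close>. Hence the ring map \<open>\<phi>\<close> with \<open>x\<^sub>i \<mapsto> x\<^sub>i\<^sup>m\<close> sends \<open>I\<^sup>(\<^sup>l\<^sup>)\<close> into \<open>I\<^sup>(\<^sup>n\<^sup>)\<close>, where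
  \<open>l = \<lceil>n/m\<rceil>\<close>, and its \<open>\<phi>\<close>-linear retraction \<open>\<psi>\<close>, which keeps only the exponents divisible by \<open>m\<close> and
  divides them by \<open>m\<close>, sends \<open>I\<^sup>(\<^sup>n\<^sup>)\<close> into \<open>I\<^sup>(\<^sup>l\<^sup>)\<close>. So \<open>\<phi>\<close> embeds the Cech complex of \<open>R/I\<^sup>(\<^sup>l\<^sup>)\<close> into that of
  \<open>R/I\<^sup>(\<^sup>n\<^sup>)\<close> as a direct summand, multiplying degrees by \<open>m\<close>, and the \<open>a\<close>-invariants compare.

  For the depth, local cohomology is avoided: any regular sequence on \<open>R/I\<^sup>(\<^sup>n\<^sup>)\<close> can be exchanged, by
  prime avoidance, for one of the same length consisting of elements of \<open>\<phi>(\<mm>)\<close>, because \<open>\<phi>(\<mm>)\<close> and \<open>\<mm>\<close>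
  lie in the same primes. A sequence \<open>\<phi>(g\<^sub>1), \<dots>, \<phi>(g\<^sub>r)\<close> that is regular on \<open>R/I\<^sup>(\<^sup>n\<^sup>)\<close> restricts to the
  direct summand \<open>R/I\<^sup>(\<^sup>l\<^sup>)\<close>, where it is \<open>g\<^sub>1, \<dots>, g\<^sub>r\<close>.
\<close>

section \<open>Regular sequences modulo ideals\<close>

text \<open>The two inclusions rest on one fact: multiplying an exponent by \<open>m\<close>
  multiplies its total degree in any set of variables by \<open>m\<close>, and \<open>l\<close> is
  the number for which \<open>n \<le> m * w\<close> and \<open>l \<le> w\<close> are equivalent.

  In the depth argument the members of a regular sequence cannot simply be replaced by powers, since
  \<phi>(f) differs from f^m in general; each \<phi>(g) is found afresh, and the rest of the
  sequence has to be rebuilt modulo it. The obstacle is that R is not local: a regular sequence may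
  lose regularity under a permutation, so members cannot be moved to the front at will. Two
  statements remain: if f is regular modulo K and h modulo K + (f), then f is regular modulo K +
  (h); and if K admits a regular pair in \<mm> and g is regular modulo K, no associated prime of K +
  (g) contains \<mm>. The second yields an auxiliary h that is regular modulo K, K + (f1) and K +
  (g) at once, and the first passes from f1 to g by way of h. Noetherianity enters twice here: zero
  divisors lie in associated primes, and these are finitely many.\<close>

definition ideal_set :: "'a::comm_ring_1 set \<Rightarrow> bool" where
  "ideal_set K \<longleftrightarrow> 0 \<in> K \<and> (\<forall>x\<in>K. \<forall>y\<in>K. x + y \<in> K) \<and> (\<forall>r. \<forall>x\<in>K. r * x \<in> K)"

definition prime_set :: "'a::comm_ring_1 set \<Rightarrow> bool" where
  "prime_set Q \<longleftrightarrow> ideal_set Q \<and> 1 \<notin> Q \<and> (\<forall>a b. a * b \<in> Q \<longrightarrow> a \<in> Q \<or> b \<in> Q)"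

definition adjoin :: "'a::comm_ring_1 set \<Rightarrow> 'a \<Rightarrow> 'a set" where
  "adjoin K f = {k + r * f | k r. k \<in> K}"

definition colon :: "'a::comm_ring_1 set \<Rightarrow> 'a \<Rightarrow> 'a set" where
  "colon K v = {r. r * v \<in> K}"

definition assoc_primes :: "'a::comm_ring_1 set \<Rightarrow> 'a set set" where
  "assoc_primes K = {Q. prime_set Q \<and> (\<exists>v. Q = colon K v)}"

definition regular_mod :: "'a::comm_ring_1 set \<Rightarrow> 'a \<Rightarrow> bool" where
  "regular_mod K f \<longleftrightarrow> (\<forall>u. f * u \<in> K \<longrightarrow> u \<in> K)"

text \<open>The requirement that the last quotient be nonzero is kept apart, so that the recursion
  runs through \<open>adjoin\<close> alone. It is restored at the end, where all ideals concerned
  lie in the irrelevant ideal.\<close>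

fun regular_seq_mod :: "'a::comm_ring_1 set \<Rightarrow> 'a list \<Rightarrow> bool" where
  "regular_seq_mod K [] \<longleftrightarrow> True"
| "regular_seq_mod K (f # fs) \<longleftrightarrow> regular_mod K f \<and> regular_seq_mod (adjoin K f) fs"

lemma ideal_setD:
  assumes "ideal_set K"
  shows "0 \<in> K" "x \<in> K \<Longrightarrow> y \<in> K \<Longrightarrow> x + y \<in> K" "x \<in> K \<Longrightarrow> r * x \<in> K" "x \<in> K \<Longrightarrow> x * r \<in> K"
    "x \<in> K \<Longrightarrow> - x \<in> K" "x \<in> K \<Longrightarrow> y \<in> K \<Longrightarrow> x - y \<in> K"
proof -
  show 1: "0 \<in> K" and 2: "x \<in> K \<Longrightarrow> y \<in> K \<Longrightarrow> x + y \<in> K" for x y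
    using assms by (auto simp: ideal_set_def)
  show 3: "x \<in> K \<Longrightarrow> r * x \<in> K" for x r
    using assms by (auto simp: ideal_set_def)
  show "x \<in> K \<Longrightarrow> x * r \<in> K"
    using 3[of x r] by (simp add: mult.commute)
  show 4: "x \<in> K \<Longrightarrow> - x \<in> K" for x
    using 3[of x "-1"] by simp
  show "x \<in> K \<Longrightarrow> y \<in> K \<Longrightarrow> x - y \<in> K"
    using 2[of x "- y"] 4[of y] by simp
qed

lemma ideal_set_add_iff:
  assumes "ideal_set K" "x \<in> K"
  shows "x + y \<in> K \<longleftrightarrow> y \<in> K"
  using ideal_setD(2)[OF assms, of y] ideal_setD(6)[OF assms(1), of "x + y" x] assms(2) by auto

lemma ideal_set_sum:
  assumes "ideal_set K" "\<And>i. i \<in> A \<Longrightarrow> f i \<in> K"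
  shows "sum f A \<in> K"
  using assms(2)
  by (induction A rule: infinite_finite_induct) (auto intro: ideal_setD[OF assms(1)])

lemma prime_set_ideal: "prime_set Q \<Longrightarrow> ideal_set Q"
  by (simp add: prime_set_def)

lemma prime_set_mult_iff:
  assumes "prime_set Q"
  shows "a * b \<in> Q \<longleftrightarrow> a \<in> Q \<or> b \<in> Q"
  using assms ideal_setD(3,4)[OF prime_set_ideal[OF assms]] by (auto simp: prime_set_def)

lemma prime_set_power_iff:
  assumes "prime_set Q" "n > 0"
  shows "a ^ n \<in> Q \<longleftrightarrow> a \<in> Q"
  using assms(2)
proof (induction n)
  case (Suc n)
  then show ?case
    using prime_set_mult_iff[OF assms(1)] by (cases "n = 0") auto
qed simp

lemma prime_set_prod:
  assumes "prime_set Q" "finite A" "prod f A \<in> Q"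
  shows "\<exists>i\<in>A. f i \<in> Q"
  using assms(2,3)
  by (induction A rule: finite_induct) (use assms(1) in \<open>auto simp: prime_set_def\<close>)

lemma ideal_set_colon:
  assumes "ideal_set K"
  shows "ideal_set (colon K v)"
  using ideal_setD(1,2,3)[OF assms] by (auto simp: ideal_set_def colon_def distrib_right mult.assoc)

lemma adjoinI: "k \<in> K \<Longrightarrow> k + r * f \<in> adjoin K f"
  by (auto simp: adjoin_def)

lemma adjoinE:
  assumes "x \<in> adjoin K f"
  obtains k r where "k \<in> K" "x = k + r * f"
  using assms by (auto simp: adjoin_def)

lemma ideal_set_adjoin:
  assumes "ideal_set K"
  shows "ideal_set (adjoin K f)"
  unfolding ideal_set_def
proof (intro conjI ballI allI)
  show "0 \<in> adjoin K f"
    using adjoinI[OF ideal_setD(1)[OF assms], of 0 f] by simp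
  fix x assume "x \<in> adjoin K f"
  then obtain k r where x: "k \<in> K" "x = k + r * f" by (rule adjoinE)
  show "s * x \<in> adjoin K f" for s
    using adjoinI[OF ideal_setD(3)[OF assms x(1)], of s "s * r" f] x by (simp add: algebra_simps)
  fix y assume "y \<in> adjoin K f"
  then obtain l s where y: "l \<in> K" "y = l + s * f" by (rule adjoinE)
  show "x + y \<in> adjoin K f"
    using adjoinI[OF ideal_setD(2)[OF assms x(1) y(1)], of "r + s" f] x y
    by (simp add: algebra_simps)
qed

lemma adjoin_superset: "K \<subseteq> adjoin K f"
proof
  fix x assume "x \<in> K"
  from adjoinI[OF this, of 0 f] show "x \<in> adjoin K f" by simp
qed

lemma adjoin_self:
  assumes "ideal_set K"
  shows "r * f \<in> adjoin K f"
  using adjoinI[OF ideal_setD(1)[OF assms], of r f] by simp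

lemma adjoin_subset:
  assumes "ideal_set L" "K \<subseteq> L" "f \<in> L"
  shows "adjoin K f \<subseteq> L"
  using ideal_setD[OF assms(1)] assms(2,3) by (auto simp: adjoin_def)

lemma adjoin_commute: "adjoin (adjoin K f) g = adjoin (adjoin K g) f"
proof -
  have "adjoin (adjoin K f) g \<subseteq> adjoin (adjoin K g) f" for f g
  proof
    fix x assume "x \<in> adjoin (adjoin K f) g"
    then obtain k r s where "k \<in> K" "x = k + r * f + s * g"
      by (metis adjoinE)
    then have "x = k + s * g + r * f" "k + s * g \<in> adjoin K g"
      using adjoinI by (auto simp: add.assoc add.commute)
    then show "x \<in> adjoin (adjoin K g) f" using adjoinI by metis
  qed
  then show ?thesis by blast
qed

lemma regular_modD: "regular_mod K f \<Longrightarrow> f * u \<in> K \<Longrightarrow> u \<in> K"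
  by (simp add: regular_mod_def)

text \<open>A relation f u = v h modulo K forces v into K + (f), and cancelling f puts u into K +
  (h). This is the half of a transposition that survives in a ring that is not local:
  \<open>h\<close> itself may be a zero divisor modulo K.\<close>

lemma regular_mod_swap:
  assumes K: "ideal_set K" and f: "regular_mod K f" and h: "regular_mod (adjoin K f) h"
  shows "regular_mod (adjoin K h) f"
  unfolding regular_mod_def
proof (intro allI impI)
  fix u assume "f * u \<in> adjoin K h"
  then obtain k v where k: "k \<in> K" "f * u = k + v * h" by (rule adjoinE)
  then have "h * v = - k + u * f" by (simp add: algebra_simps)
  then have "h * v \<in> adjoin K f" using adjoinI[OF ideal_setD(5)[OF K k(1)]] by metis
  then have "v \<in> adjoin K f" by (rule regular_modD[OF h])
  then obtain k' w where k': "k' \<in> K" "v = k' + w * f" by (rule adjoinE)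
  have "f * (u - h * w) = k + h * k'"
    using k(2) k'(2) by (simp add: algebra_simps)
  also have "\<dots> \<in> K" by (intro ideal_setD(2,3)[OF K] k(1) k'(1))
  finally have "u - h * w \<in> K" by (rule regular_modD[OF f])
  from adjoinI[OF this, of w h] show "u \<in> adjoin K h" by (simp add: algebra_simps)
qed

section \<open>Associated primes, prime avoidance, and exchange in regular sequences\<close>

lemma regular_mod_not_subset_assoc:
  assumes "regular_mod K f" "f \<in> \<mm>" "Q \<in> assoc_primes K"
  shows "\<not> \<mm> \<subseteq> Q"
proof
  assume "\<mm> \<subseteq> Q"
  with assms obtain v where Q: "prime_set Q" "Q = colon K v" "f * v \<in> K"
    by (auto simp: assoc_primes_def colon_def)
  then have "v \<in> K" using assms(1) regular_modD by blast
  with Q show False by (auto simp: prime_set_def colon_def)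
qed

text \<open>
  Exactness of the Koszul complex of \<open>f\<^sub>1, f\<^sub>2\<close> at the middle term lets one exchange \<open>f\<^sub>1\<close> for \<open>g\<close>
  without knowing that \<open>f\<^sub>2\<close> is regular modulo \<open>K + (g)\<close>.
\<close>

lemma regular_pair_not_subset_assoc:
  assumes K: "ideal_set K" and f: "regular_mod K f1" "regular_mod (adjoin K f1) f2"
    and m: "f1 \<in> \<mm>" "f2 \<in> \<mm>" and g: "regular_mod K g" and Q: "Q \<in> assoc_primes (adjoin K g)"
  shows "\<not> \<mm> \<subseteq> Q"
proof
  assume "\<mm> \<subseteq> Q"
  from Q obtain u where u: "prime_set Q" "Q = colon (adjoin K g) u"
    by (auto simp: assoc_primes_def)
  with m \<open>\<mm> \<subseteq> Q\<close> have "f1 * u \<in> adjoin K g" "f2 * u \<in> adjoin K g"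
    by (auto simp: colon_def)
  then obtain a v b w where 1: "a \<in> K" "f1 * u = a + v * g" and 2: "b \<in> K" "f2 * u = b + w * g"
    by (metis adjoinE)
  \<comment> \<open>Expanding \<open>f1 * f2 * u\<close> in two ways gives a multiple of
    \<open>g\<close> in \<open>K\<close>; cancelling \<open>g\<close> leaves the Koszul relation
    between \<open>v\<close> and \<open>w\<close>.\<close>
  have "g * (f2 * v - f1 * w) = f2 * (v * g) - f1 * (w * g)" by (simp add: algebra_simps)
  also have "\<dots> = f2 * (f1 * u - a) - f1 * (f2 * u - b)" using 1 2 by simp
  also have "\<dots> = f1 * b - f2 * a" by (simp add: algebra_simps)
  also have "\<dots> \<in> K" by (intro ideal_setD(3,6)[OF K] 1(1) 2(1))
  finally have 3: "f2 * v - f1 * w \<in> K" by (rule regular_modD[OF g])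
  have "f2 * v \<in> adjoin K f1"
    using adjoinI[OF 3, of w f1] by (simp add: algebra_simps)
  then have "v \<in> adjoin K f1" by (rule regular_modD[OF f(2)])
  then obtain c v' where c: "c \<in> K" "v = c + v' * f1" by (rule adjoinE)
  have "f1 * (u - v' * g) = a + c * g" using 1 c by (simp add: algebra_simps)
  also have "\<dots> \<in> K" by (intro ideal_setD(2,4)[OF K] 1(1) c(1))
  finally have "u - v' * g \<in> K" by (rule regular_modD[OF f(1)])
  from adjoinI[OF this, of v' g] have "u \<in> adjoin K g" by simp
  with u show False by (auto simp: prime_set_def colon_def)
qed

text \<open>By induction there is, for each Q, an element \<open>f Q\<close> of \<mm> that avoids
  all the other primes. If every \<open>f Q\<close> lies in its own Q, add to \<open>f P\<close> the
  product of the others: at P only the product stays outside, at every other prime only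
  \<open>f P\<close> does.\<close>

lemma prime_avoidance:
  assumes "finite \<Q>" "\<And>Q. Q \<in> \<Q> \<Longrightarrow> prime_set Q" "ideal_set \<mm>" "\<And>Q. Q \<in> \<Q> \<Longrightarrow> \<not> \<mm> \<subseteq> Q"
  shows "\<exists>f\<in>\<mm>. \<forall>Q\<in>\<Q>. f \<notin> Q"
  using assms(1,2,4)
proof (induction \<Q> rule: finite_psubset_induct)
  case (psubset \<Q>)
  show ?case
  proof (cases "\<Q> = {}")
    case True
    then show ?thesis using ideal_setD(1)[OF assms(3)] by blast
  next
    case False
    then obtain P where P: "P \<in> \<Q>" by blast
    have "\<exists>f\<in>\<mm>. \<forall>Q'\<in>\<Q> - {Q}. f \<notin> Q'" if "Q \<in> \<Q>" for Q
      using that psubset.prems by (intro psubset.IH) auto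
    then obtain f where f: "\<And>Q. Q \<in> \<Q> \<Longrightarrow> f Q \<in> \<mm>"
      "\<And>Q Q'. Q \<in> \<Q> \<Longrightarrow> Q' \<in> \<Q> \<Longrightarrow> Q' \<noteq> Q \<Longrightarrow> f Q \<notin> Q'"
      by (metis DiffI singletonD)
    show ?thesis
    proof (cases "\<exists>Q\<in>\<Q>. f Q \<notin> Q")
      case True
      then show ?thesis using f by metis
    next
      case all: False
      show ?thesis
      \<comment> \<open>A single prime is treated apart because the product below would be empty,
        and 1 need not lie in \<mm>.\<close>
      proof (cases "\<Q> = {P}")
        case True
        then show ?thesis using psubset.prems(2) P by blast
      next
        case False
        define h where "h = prod f (\<Q> - {P})"
        have fin: "finite (\<Q> - {P})" using psubset.hyps by simp
        have hQ: "h \<in> Q" if "Q \<in> \<Q>" "Q \<noteq> P" for Q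
        proof -
          have "h = f Q * prod f (\<Q> - {P} - {Q})"
            unfolding h_def using that fin by (simp add: prod.remove)
          then show ?thesis
            using all that(1) ideal_setD(4)[OF prime_set_ideal[OF psubset.prems(1)[OF that(1)]], of "f Q"]
            by blast
        qed
        have hP: "h \<notin> P"
        proof
          assume "h \<in> P"
          then obtain Q where "Q \<in> \<Q> - {P}" "f Q \<in> P"
            using prime_set_prod[OF psubset.prems(1)[OF P] fin] unfolding h_def by blast
          with f(2)[of Q P] P show False by auto
        qed
        have "h \<in> \<mm>"
        proof -
          obtain Q where Q: "Q \<in> \<Q> - {P}" using False P by blast
          have "h = f Q * prod f (\<Q> - {P} - {Q})"
            unfolding h_def using Q fin by (simp add: prod.remove)
          then show ?thesis using f(1) Q ideal_setD(4)[OF assms(3)] by auto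
        qed
        then have "f P + h \<in> \<mm>" using f(1) P ideal_setD(2)[OF assms(3)] by blast
        moreover have "f P + h \<notin> Q" if Q: "Q \<in> \<Q>" for Q
        proof (cases "Q = P")
          case True
          then show ?thesis
            using hP all P ideal_set_add_iff[OF prime_set_ideal[OF psubset.prems(1)[OF P]]] by auto
        next
          case False
          then show ?thesis
            using hQ[OF Q False] f(2)[OF P Q] Q
              ideal_set_add_iff[OF prime_set_ideal[OF psubset.prems(1)[OF Q]], of h "f P"]
            by (auto simp: add.commute)
        qed
        ultimately show ?thesis by blast
      qed
    qed
  qed
qed

text \<open>The ascending chain condition as well-foundedness of reverse inclusion. This form serves
  both the choice of maximal ideals and induction from larger ideals to smaller ones.\<close>

locale noetherian_type =
  fixes ring_type :: "'a::comm_ring_1 itself"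
  assumes wf_ideals: "wf {(L, K :: 'a set). ideal_set K \<and> ideal_set L \<and> K \<subset> L}"
begin

lemma maximal_ideal_exists:
  assumes "\<F> \<noteq> {}" "\<And>K :: 'a set. K \<in> \<F> \<Longrightarrow> ideal_set K"
  shows "\<exists>K\<in>\<F>. \<forall>L\<in>\<F>. \<not> K \<subset> L"
proof -
  obtain x where "x \<in> \<F>" using assms by blast
  with wf_ideals[unfolded wf_eq_minimal, rule_format, of x \<F>]
  obtain K where K: "K \<in> \<F>"
    "\<And>L. (L, K) \<in> {(L, K). ideal_set K \<and> ideal_set L \<and> K \<subset> L} \<Longrightarrow> L \<notin> \<F>"
    by auto
  then show ?thesis using assms(2) by blast
qed

text \<open>Maximal annihilators are prime; here only annihilators of nonzero classes killed by
  \<open>f\<close> compete, so that the prime contains \<open>f\<close>. If a b kills v and b does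
  not, then b v competes as well, and by maximality its annihilator, which contains a, equals that
  of v.\<close>

lemma zero_divisor_in_assoc:
  assumes "ideal_set (K :: 'a set)" "\<not> regular_mod K f"
  shows "\<exists>Q\<in>assoc_primes K. f \<in> Q"
proof -
  define \<F> where "\<F> = {colon K v | v. v \<notin> K \<and> f * v \<in> K}"
  have "\<F> \<noteq> {}" using assms(2) by (auto simp: \<F>_def regular_mod_def)
  moreover have "\<And>L. L \<in> \<F> \<Longrightarrow> ideal_set L" using assms by (auto simp: \<F>_def ideal_set_colon)
  ultimately obtain P where P: "P \<in> \<F>" "\<And>L. L \<in> \<F> \<Longrightarrow> \<not> P \<subset> L"
    using maximal_ideal_exists by metis
  then obtain v where v: "P = colon K v" "v \<notin> K" "f * v \<in> K" by (auto simp: \<F>_def)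
  have "a \<in> P" if ab: "a * b \<in> P" and b: "b \<notin> P" for a b
  proof -
    have "colon K (b * v) \<in> \<F>"
      using b v ideal_setD(3)[OF assms(1) v(3), of b]
      by (auto simp: \<F>_def colon_def algebra_simps intro!: exI[of _ "b * v"])
    moreover have "P \<subseteq> colon K (b * v)"
      using v ideal_setD(3)[OF assms(1), of _ b] by (fastforce simp: colon_def mult.left_commute)
    ultimately have "P = colon K (b * v)" using P by blast
    moreover have "a \<in> colon K (b * v)" using ab v(1) by (simp add: colon_def mult.assoc)
    ultimately show ?thesis by simp
  qed
  then have "prime_set P"
    using v assms(1) ideal_set_colon by (auto simp: prime_set_def colon_def)
  then show ?thesis using v by (auto simp: assoc_primes_def colon_def)
qed

text \<open>For an associated prime P = \<open>colon K u\<close> and L = K + (u), the module L/K is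
  a copy of R/P, whose only associated prime is P. Hence passing from L to K adds at most P, and L
  is strictly larger than K.\<close>

lemma finite_assoc_primes:
  assumes "ideal_set (K :: 'a set)"
  shows "finite (assoc_primes K)"
  using assms
proof (induction K rule: wf_induct[OF wf_ideals])
  case (1 K)
  then have K: "ideal_set K" by blast
  show ?case
  proof (cases "assoc_primes K = {}")
    case False
    then obtain P u where P: "prime_set P" "P = colon K u" by (auto simp: assoc_primes_def)
    then have u: "u \<notin> K" by (auto simp: prime_set_def colon_def)
    define L where "L = adjoin K u"
    have L: "ideal_set L" "K \<subset> L"
      using ideal_set_adjoin[OF K] adjoin_superset[of K u] adjoin_self[OF K, of 1 u] u
      by (auto simp: L_def)
    with 1 K have fin: "finite (assoc_primes L)" by blast
    have "Q \<in> insert P (assoc_primes L)" if Q: "Q \<in> assoc_primes K" for Q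
    proof -
      from Q obtain v where v: "prime_set Q" "Q = colon K v" by (auto simp: assoc_primes_def)
      show ?thesis
      \<comment> \<open>The question is whether the copy of R/Q generated by the class of
        \<open>v\<close> meets L/K. If it does, Q annihilates a nonzero element of R/P and equals P;
        if not, \<open>v\<close> has the same annihilator modulo L.\<close>
      proof (cases "\<exists>a. a * v \<in> L \<and> a * v \<notin> K")
        case True
        then obtain a where a: "a * v \<in> L" "a * v \<notin> K" by blast
        then obtain k b where k: "k \<in> K" "a * v = k + b * u"
          unfolding L_def by (metis adjoinE)
        have bu: "r * (a * v) \<in> K \<longleftrightarrow> r * (b * u) \<in> K" for r
          using ideal_set_add_iff[OF K ideal_setD(3)[OF K k(1), of r], of "r * (b * u)"] k(2)
          by (simp add: distrib_left)
        have "r \<in> Q \<longleftrightarrow> r \<in> P" for r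
        proof -
          have "r \<in> Q \<longleftrightarrow> r * a \<in> Q"
            using prime_set_mult_iff[OF v(1)] a(2) v(2) by (auto simp: colon_def)
          also have "\<dots> \<longleftrightarrow> r * (a * v) \<in> K" using v(2) by (simp add: colon_def mult.assoc)
          also have "\<dots> \<longleftrightarrow> r * b \<in> P" using P(2) bu by (simp add: colon_def mult.assoc)
          also have "\<dots> \<longleftrightarrow> r \<in> P"
            using prime_set_mult_iff[OF P(1)] bu[of 1] a(2) P(2) by (auto simp: colon_def)
          finally show ?thesis .
        qed
        then show ?thesis by blast
      next
        case False
        then have "colon L v = Q" using v(2) L(2) by (auto simp: colon_def)
        then show ?thesis using v(1) by (auto simp: assoc_primes_def)
      qed
    qed
    then show ?thesis using fin finite_subset[of "assoc_primes K" "insert P (assoc_primes L)"] by blast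
  qed simp
qed

lemma exists_regular_element:
  assumes "finite \<L>" "\<And>L :: 'a set. L \<in> \<L> \<Longrightarrow> ideal_set L" "ideal_set \<mm>"
    and "\<And>L Q. L \<in> \<L> \<Longrightarrow> Q \<in> assoc_primes L \<Longrightarrow> \<not> \<mm> \<subseteq> Q"
  shows "\<exists>h\<in>\<mm>. \<forall>L\<in>\<L>. regular_mod L h"
proof -
  have "\<exists>h\<in>\<mm>. \<forall>Q\<in>\<Union>(assoc_primes ` \<L>). h \<notin> Q"
    using assms finite_assoc_primes
    by (intro prime_avoidance) (auto simp: assoc_primes_def)
  then show ?thesis using zero_divisor_in_assoc assms(2) by (metis UN_iff)
qed

text \<open>A regular element \<open>g\<close> costs exactly one member of the sequence. The
  induction hypothesis is used twice: modulo K + (f1) it trades the remaining members for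
  \<open>a\<close> regular modulo K + (f1, h), so that f1, a is regular modulo K + (h) by a swap;
  applied there to \<open>g\<close>, it gives \<open>b\<close> regular modulo K + (h, g). Then h, b
  is regular modulo K + (g).\<close>

lemma regular_seq_mod_adjoin:
  assumes "ideal_set \<mm>" "ideal_set (K :: 'a set)" "regular_seq_mod K fs" "set fs \<subseteq> \<mm>"
    "length fs = Suc r" "g \<in> \<mm>" "regular_mod K g"
  shows "\<exists>gs. length gs = r \<and> set gs \<subseteq> \<mm> \<and> regular_seq_mod (adjoin K g) gs"
  using assms(2-)
proof (induction r arbitrary: K fs g)
  case 0
  then show ?case by auto
next
  case (Suc r)
  then obtain f1 f2 fs' where fs: "fs = f1 # f2 # fs'"
    by (metis length_Suc_conv)
  note K = \<open>ideal_set K\<close> and g = \<open>regular_mod K g\<close>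
  have f: "regular_mod K f1" "regular_mod (adjoin K f1) f2" "f1 \<in> \<mm>" "f2 \<in> \<mm>"
    using Suc.prems fs by auto
  \<comment> \<open>No associated prime of these three ideals contains \<mm>: \<open>f1\<close>
    shows it for the first, \<open>f2\<close> for the second, and the Koszul argument for the
    third.\<close>
  have "\<exists>h\<in>\<mm>. \<forall>L\<in>{K, adjoin K f1, adjoin K g}. regular_mod L h"
  proof (rule exists_regular_element)
    fix L Q assume "L \<in> {K, adjoin K f1, adjoin K g}" "Q \<in> assoc_primes L"
    then show "\<not> \<mm> \<subseteq> Q"
      using regular_mod_not_subset_assoc[OF f(1,3)] regular_mod_not_subset_assoc[OF f(2,4)]
        regular_pair_not_subset_assoc[OF K f g] by blast
  qed (use K assms(1) ideal_set_adjoin in auto)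
  then obtain h where h: "h \<in> \<mm>" "regular_mod K h" "regular_mod (adjoin K f1) h"
    "regular_mod (adjoin K g) h" by auto
  obtain a where a: "length a = r" "set a \<subseteq> \<mm>" "regular_seq_mod (adjoin (adjoin K f1) h) a"
    using Suc.IH[of "adjoin K f1" "f2 # fs'" h] Suc.prems fs h ideal_set_adjoin[OF K] by auto
  have "regular_seq_mod (adjoin K h) (f1 # a)"
    using a(3) regular_mod_swap[OF K f(1) h(3)] by (simp add: adjoin_commute)
  then obtain b where b: "length b = r" "set b \<subseteq> \<mm>" "regular_seq_mod (adjoin (adjoin K h) g) b"
    using Suc.IH[of "adjoin K h" "f1 # a" g] a f Suc.prems ideal_set_adjoin[OF K]
      regular_mod_swap[OF K g h(4)] by auto
  have "regular_seq_mod (adjoin K g) (h # b)"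
    using h(4) b(3) by (simp add: adjoin_commute)
  then show ?case using b h by (intro exI[of _ "h # b"]) auto
qed

text \<open>The primes to be avoided are the contractions along \<phi> of the associated primes, not
  these primes themselves, because the new element must have the form \<phi>(g) with g in \<mm>. The
  exchange lemma shortens the sequence by one modulo K + (\<phi>(g)), where the induction
  continues.\<close>

lemma regular_seq_mod_in_image:
  assumes m: "ideal_set \<mm>" and phi: "\<phi> 0 = 0" "\<phi> 1 = 1" "\<And>x y. \<phi> (x + y) = \<phi> x + \<phi> y"
    "\<And>x y. \<phi> (x * y) = \<phi> x * \<phi> y"
    and sub: "\<And>x. x \<in> \<mm> \<Longrightarrow> \<phi> x \<in> \<mm>" "\<And>Q. prime_set Q \<Longrightarrow> \<phi> ` \<mm> \<subseteq> Q \<Longrightarrow> \<mm> \<subseteq> Q"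
    and "ideal_set (K :: 'a set)" "regular_seq_mod K fs" "set fs \<subseteq> \<mm>"
  shows "\<exists>gs. length gs = length fs \<and> set gs \<subseteq> \<mm> \<and> regular_seq_mod K (map \<phi> gs)"
  using assms(8-)
proof (induction "length fs" arbitrary: K fs)
  case 0
  then show ?case by auto
next
  case (Suc r)
  note K = \<open>ideal_set K\<close>
  obtain f fs' where fs: "fs = f # fs'" using Suc.hyps(2) by (metis length_Suc_conv)
  have "\<exists>g\<in>\<mm>. \<forall>P\<in>(\<lambda>Q. \<phi> -` Q) ` assoc_primes K. g \<notin> P"
  proof (rule prime_avoidance)
    show "prime_set P" if P: "P \<in> (\<lambda>Q. \<phi> -` Q) ` assoc_primes K" for P
    proof -
      obtain Q where Q: "P = \<phi> -` Q" "prime_set Q" using P by (auto simp: assoc_primes_def)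
      then show ?thesis
        using prime_set_mult_iff[OF Q(2)] ideal_setD[OF prime_set_ideal[OF Q(2)]]
        by (auto simp: prime_set_def ideal_set_def phi)
    qed
    show "\<not> \<mm> \<subseteq> P" if P: "P \<in> (\<lambda>Q. \<phi> -` Q) ` assoc_primes K" for P
    proof -
      obtain Q where Q: "P = \<phi> -` Q" "Q \<in> assoc_primes K" using P by blast
      moreover have "prime_set Q" using Q by (simp add: assoc_primes_def)
      moreover have "\<not> \<mm> \<subseteq> Q"
        using regular_mod_not_subset_assoc[of K f \<mm> Q] Suc.prems fs Q by auto
      ultimately show ?thesis using sub(2) by blast
    qed
  qed (use finite_assoc_primes[OF K] m in auto)
  then obtain g where g: "g \<in> \<mm>" "regular_mod K (\<phi> g)"
    using zero_divisor_in_assoc[OF K] by (metis imageI vimageI)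
  obtain a where a: "length a = r" "set a \<subseteq> \<mm>" "regular_seq_mod (adjoin K (\<phi> g)) a"
    using regular_seq_mod_adjoin[OF m K Suc.prems(2,3) _ sub(1)[OF g(1)] g(2)] Suc.hyps(2) by metis
  with Suc.hyps(1)[of a "adjoin K (\<phi> g)"] ideal_set_adjoin[OF K]
  obtain gs where "length gs = length a" "set gs \<subseteq> \<mm>" "regular_seq_mod (adjoin K (\<phi> g)) (map \<phi> gs)"
    by auto
  then show ?case using g a Suc.hyps(2) by (intro exI[of _ "g # gs"]) auto
qed

end

text \<open>
  Here \<open>\<phi>\<close> embeds \<open>R/K\<close> into \<open>R/L\<close> and \<open>\<psi>\<close> is a \<open>\<phi>\<close>-linear retraction.
\<close>

lemma regular_seq_mod_retract:
  assumes "\<And>x y. \<phi> (x + y) = \<phi> x + \<phi> y" "\<And>x y. \<phi> (x * y) = \<phi> x * \<phi> y"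
    and "\<And>x y. \<psi> (x + y) = \<psi> x + \<psi> y" "\<And>x y. \<psi> (\<phi> x * y) = x * \<psi> y" "\<And>x. \<psi> (\<phi> x) = x"
    and "\<phi> ` K \<subseteq> L" "\<psi> ` L \<subseteq> K" "regular_seq_mod L (map \<phi> gs)"
  shows "regular_seq_mod K gs"
  using assms(6-)
proof (induction gs arbitrary: K L)
  case (Cons g gs)
  have "regular_mod K g"
    unfolding regular_mod_def
  proof (intro allI impI)
    fix u assume "g * u \<in> K"
    then have "\<phi> g * \<phi> u \<in> L" using Cons.prems(1) assms(2) by (metis image_subset_iff)
    then have "\<phi> u \<in> L" using Cons.prems(3) by (simp add: regular_mod_def)
    then have "\<psi> (\<phi> u) \<in> K" using Cons.prems(2) by blast
    then show "u \<in> K" by (simp add: assms(5))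
  qed
  moreover have "\<phi> ` adjoin K g \<subseteq> adjoin L (\<phi> g)"
    using Cons.prems(1) by (auto simp: assms(1,2) elim!: adjoinE intro!: adjoinI)
  \<comment> \<open>The splitting survives the passage to K + (g) and L + (\<phi>(g)) because
    \<psi>(r \<phi>(g)) = \<psi>(r) g.\<close>
  moreover have "\<psi> ` adjoin L (\<phi> g) \<subseteq> adjoin K g"
  proof -
    have "\<psi> (k + r * \<phi> g) \<in> adjoin K g" if "k \<in> L" for k r
      using adjoinI[of "\<psi> k" K "\<psi> r" g] that Cons.prems(2) assms(3) assms(4)[of g r]
      by (auto simp: mult.commute)
    then show ?thesis by (auto elim!: adjoinE)
  qed
  ultimately show ?case using Cons.IH Cons.prems(3) by auto
qed simp

section \<open>The polynomial ring is Noetherian\<close>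

text \<open>Every sequence has a monotone subsequence, and a decreasing one in the naturals is
  constant from the index of its minimum on.\<close>

lemma incseq_subseq_nat:
  fixes s :: "nat \<Rightarrow> nat"
  shows "\<exists>r. strict_mono r \<and> incseq (\<lambda>n. s (r n))"
proof -
  obtain f where f: "strict_mono f" "monoseq (\<lambda>n. s (f n))"
    using seq_monosub by blast
  show ?thesis
  proof (cases "incseq (\<lambda>n. s (f n))")
    case False
    then have dec: "decseq (\<lambda>n. s (f n))"
      using f(2) by (simp add: monoseq_iff)
    define N where "N = (ARG_MIN (\<lambda>n. s (f n)) n. True)"
    have min: "s (f N) \<le> s (f n)" for n
      unfolding N_def by (rule arg_min_nat_le) simp
    have "s (f (n + N)) = s (f N)" for n
      using min[of "n + N"] decseqD[OF dec, of N "n + N"] by simp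
    then show ?thesis
      using f(1) by (intro exI[of _ "\<lambda>n. f (n + N)"]) (auto simp: strict_mono_def incseq_def)
  qed (use f in blast)
qed

text \<open>Passing to subsequences one variable at a time makes all coordinates increasing along a
  common subsequence; its first two terms give the pair.\<close>

lemma dickson:
  fixes f :: "nat \<Rightarrow> 'x::finite \<Rightarrow> nat"
  shows "\<exists>i j. i < j \<and> (\<forall>x. f i x \<le> f j x)"
proof -
  have "\<exists>r :: nat \<Rightarrow> nat. strict_mono r \<and> (\<forall>x\<in>A. incseq (\<lambda>n. f (r n) x))" for A :: "'x set"
  proof (induction A rule: finite_induct[OF finite])
    case 1
    show ?case by (auto intro: strict_mono_id[unfolded id_def])
  next
    case (2 x A)
    then obtain r where r: "strict_mono r" "\<forall>x\<in>A. incseq (\<lambda>n. f (r n) x)" by blast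
    obtain q where q: "strict_mono q" "incseq (\<lambda>n. f (r (q n)) x)"
      using incseq_subseq_nat[of "\<lambda>n. f (r n) x"] by blast
    have "incseq (\<lambda>n. f (r (q n)) y)" if "y \<in> A" for y
      using r(2) that q(1) unfolding incseq_def by (simp add: strict_mono_less_eq)
    then show ?case
      using r(1) q by (intro exI[of _ "r \<circ> q"]) (auto simp: strict_mono_def)
  qed
  then obtain r :: "nat \<Rightarrow> nat" where "strict_mono r" "\<forall>x. incseq (\<lambda>n. f (r n) x)"
    by (metis UNIV_I)
  then show ?thesis
    by (intro exI[of _ "r 0"] exI[of _ "r 1"]) (auto simp: strict_mono_def incseq_def)
qed

text \<open>The order on exponents is lexicographic: \<open>less_fun\<close> compares at the first
  variable where they differ. That it extends divisibility is what lets Dickson's lemma exclude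
  infinite descent.\<close>

lemma poly_mapping_lookup_le_imp_le:
  fixes a b :: "'x::{finite,linorder} \<Rightarrow>\<^sub>0 nat"
  assumes "\<And>x. Poly_Mapping.lookup a x \<le> Poly_Mapping.lookup b x"
  shows "a \<le> b"
proof (rule ccontr)
  assume "\<not> a \<le> b"
  then have "less_fun (Poly_Mapping.lookup b) (Poly_Mapping.lookup a)"
    by (simp add: not_le less_poly_mapping.rep_eq)
  then show False using assms by (auto simp: less_fun_def not_le[symmetric])
qed

lemma wf_less_poly_mapping: "wf {(a, b :: 'x::{finite,linorder} \<Rightarrow>\<^sub>0 nat). a < b}"
  unfolding wf_iff_no_infinite_down_chain
proof
  assume "\<exists>f. \<forall>i. (f (Suc i), f i) \<in> {(a, b :: 'x \<Rightarrow>\<^sub>0 nat). a < b}"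
  then obtain f :: "nat \<Rightarrow> 'x \<Rightarrow>\<^sub>0 nat" where f: "\<And>i. f (Suc i) < f i" by auto
  obtain i j where "i < j" "\<forall>x. Poly_Mapping.lookup (f i) x \<le> Poly_Mapping.lookup (f j) x"
    using dickson[of "\<lambda>n. Poly_Mapping.lookup (f n)"] by blast
  moreover have "f j < f i" if "i < j" for i j
    using that by (induction rule: strict_inc_induct) (use f in \<open>auto intro: less_trans\<close>)
  ultimately show False using poly_mapping_lookup_le_imp_le[of "f i" "f j"] by (simp add: not_le[symmetric])
qed

lemma poly_mapping_sum_single: "f = (\<Sum>a\<in>Poly_Mapping.keys f. Poly_Mapping.single a (Poly_Mapping.lookup f a))"
  by (rule poly_mapping_eqI)
    (auto simp: lookup_sum lookup_single when_def sum.If_cases in_keys_iff if_distrib cong: if_cong)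

lemma poly_mapping_add_induct [case_names single add]:
  fixes f :: "'a \<Rightarrow>\<^sub>0 'b::comm_monoid_add"
  assumes "\<And>a c. P (Poly_Mapping.single a c)" "\<And>f g. P f \<Longrightarrow> P g \<Longrightarrow> P (f + g)"
  shows "P f"
proof -
  have "P (\<Sum>a\<in>A. Poly_Mapping.single a (c a))" for A c
    using assms(1)[of undefined 0]
    by (induction A rule: infinite_finite_induct) (auto intro: assms)
  then show ?thesis using poly_mapping_sum_single by metis
qed

lemma lookup_single_mult:
  fixes f :: "'a::cancel_comm_monoid_add \<Rightarrow>\<^sub>0 'k::comm_semiring_1"
  shows "Poly_Mapping.lookup (Poly_Mapping.single b c * f) (b + a) = c * Poly_Mapping.lookup f a"
  by (induction f rule: poly_mapping_add_induct)
    (auto simp: mult_single lookup_single lookup_add distrib_left when_def)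

lemma keys_single_mult:
  fixes f :: "'a::cancel_comm_monoid_add \<Rightarrow>\<^sub>0 'k::comm_semiring_1"
  shows "Poly_Mapping.keys (Poly_Mapping.single b c * f) \<subseteq> (+) b ` Poly_Mapping.keys f"
  using keys_mult[of "Poly_Mapping.single b c" f] by (auto split: if_splits)

text \<open>
  In a strictly ascending chain, choose \<open>f\<^sub>i \<in> K\<^sub>i\<^sub>+\<^sub>1 - K\<^sub>i\<close> with minimal leading monomial. By Dickson's
  lemma some leading monomial divides a later one, and cancelling the latter contradicts minimality.
\<close>

lemma mpoly_noetherian:
  "wf {(L, K :: ('x::{finite,linorder}, 'k::field) mpoly set). ideal_set K \<and> ideal_set L \<and> K \<subset> L}"
  unfolding wf_iff_no_infinite_down_chain
proof
  assume "\<exists>K. \<forall>i. (K (Suc i), K i) \<in>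
    {(L, K :: ('x, 'k) mpoly set). ideal_set K \<and> ideal_set L \<and> K \<subset> L}"
  then obtain K :: "nat \<Rightarrow> ('x, 'k) mpoly set" where
    "\<And>i. ideal_set (K i) \<and> ideal_set (K (Suc i)) \<and> K i \<subset> K (Suc i)" by auto
  then have K: "\<And>i. ideal_set (K i)" "\<And>i. K i \<subset> K (Suc i)" by blast+
  define lm :: "('x, 'k) mpoly \<Rightarrow> ('x \<Rightarrow>\<^sub>0 nat)" where "lm f = Max (Poly_Mapping.keys f)" for f
  have "\<exists>f\<in>K (Suc i) - K i. \<forall>g\<in>K (Suc i) - K i. \<not> lm g < lm f" for i
  proof -
    obtain f where "f \<in> K (Suc i) - K i" using K(2)[of i] by blast
    then show ?thesis
      using wf_inv_image[OF wf_less_poly_mapping, of lm, unfolded wf_eq_minimal,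
          rule_format, of f "K (Suc i) - K i"]
      by (auto simp: inv_image_def)
  qed
  then obtain f where f: "\<And>i. f i \<in> K (Suc i) - K i"
    "\<And>i g. g \<in> K (Suc i) - K i \<Longrightarrow> \<not> lm g < lm (f i)" by metis
  obtain i j where ij: "i < j"
    "\<And>x. Poly_Mapping.lookup (lm (f i)) x \<le> Poly_Mapping.lookup (lm (f j)) x"
    using dickson[of "\<lambda>n. Poly_Mapping.lookup (lm (f n))"] by blast
  have nz: "f i \<noteq> 0" for i
    using f(1)[of i] ideal_setD(1)[OF K(1)] by auto
  have lm: "lm g \<in> Poly_Mapping.keys g" "\<And>a. a \<in> Poly_Mapping.keys g \<Longrightarrow> a \<le> lm g" if "g \<noteq> 0" for g
    using that by (auto simp: lm_def)
  define b where "b = lm (f j) - lm (f i)"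
  have b: "b + lm (f i) = lm (f j)"
    using ij(2) by (intro poly_mapping_eqI) (simp add: b_def lookup_add lookup_minus)
  define c where "c = Poly_Mapping.lookup (f j) (lm (f j)) / Poly_Mapping.lookup (f i) (lm (f i))"
  define h where "h = Poly_Mapping.single b c * f i"
  define g where "g = f j - h"
  have "K (Suc i) \<subseteq> K j"
    using lift_Suc_mono_le[of K, OF psubset_imp_subset[OF K(2)]] ij(1) by (simp add: Suc_le_eq)
  then have "h \<in> K j" using f(1)[of i] ideal_setD(3)[OF K(1)] by (auto simp: h_def)
  \<comment> \<open>Subtracting an element of \<open>K j\<close> keeps \<open>f j\<close> outside
    \<open>K j\<close>, so \<open>g\<close> competes with \<open>f j\<close> for the smallest
    leading monomial.\<close>
  then have g: "g \<in> K (Suc j) - K j"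
    using f(1)[of j] K(2)[of j] ideal_setD(6)[OF K(1), of "f j" "Suc j" h]
      ideal_setD(2)[OF K(1), of g j h]
    by (auto simp: g_def psubset_eq)
  then have "g \<noteq> 0" using ideal_setD(1)[OF K(1)] by auto
  have "Poly_Mapping.lookup (f i) (lm (f i)) \<noteq> 0"
    using lm(1)[OF nz] by (simp add: in_keys_iff)
  then have "Poly_Mapping.lookup h (lm (f j)) = Poly_Mapping.lookup (f j) (lm (f j))"
    using lookup_single_mult[of b c "f i" "lm (f i)"] by (simp add: h_def b c_def)
  then have "lm (f j) \<notin> Poly_Mapping.keys g"
    by (simp add: g_def in_keys_iff lookup_minus)
  moreover have "a \<le> lm (f j)" if "a \<in> Poly_Mapping.keys g" for a
  proof -
    have "a \<in> Poly_Mapping.keys (f j) \<or> a \<in> Poly_Mapping.keys h"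
      using that by (auto simp: g_def in_keys_iff lookup_minus)
    then show ?thesis
    proof
      assume "a \<in> Poly_Mapping.keys h"
      then obtain a' where "a = b + a'" "a' \<in> Poly_Mapping.keys (f i)"
        using keys_single_mult unfolding h_def by blast
      then show ?thesis using add_left_mono[OF lm(2)[OF nz], of a' i b] b by simp
    qed (use lm(2)[OF nz] in blast)
  qed
  ultimately have "lm g < lm (f j)" using lm(1)[OF \<open>g \<noteq> 0\<close>] by (metis order_neq_le_trans)
  then show False using f(2)[OF g] by blast
qed

interpretation mpoly: noetherian_type "TYPE(('x::{finite,linorder}, 'k::field) mpoly)"
  by unfold_locales (rule mpoly_noetherian)


section \<open>Powers of the variables\<close>

definition scale :: "nat \<Rightarrow> ('x \<Rightarrow>\<^sub>0 nat) \<Rightarrow> ('x \<Rightarrow>\<^sub>0 nat)" where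
  "scale m a = Poly_Mapping.map ((*) m) a"

lemma lookup_scale [simp]: "Poly_Mapping.lookup (scale m a) x = m * Poly_Mapping.lookup a x"
  by (simp add: scale_def Poly_Mapping.map.rep_eq when_def)

lemma scale_add: "scale m (a + b) = scale m a + scale m b"
  by (rule poly_mapping_eqI) (simp add: lookup_add algebra_simps)

lemma scale_zero [simp]: "scale m 0 = 0"
  by (rule poly_mapping_eqI) simp

lemma inj_scale: "m > 0 \<Longrightarrow> inj (scale m)"
  by (rule injI) (auto simp: poly_mapping_eq_iff fun_eq_iff dest!: arg_cong[of _ _ Poly_Mapping.lookup])

text \<open>The reason why \<psi> is \<phi>-linear: multiplication by a monomial with exponent
  \<open>scale m a\<close> never turns a term that \<psi> discards into one that it keeps.\<close>

lemma scale_add_in_range: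
  assumes "m > 0" "scale m a + b \<in> range (scale m)"
  shows "b \<in> range (scale m)"
proof -
  obtain e where e: "scale m a + b = scale m e" using assms by blast
  have "b = scale m (e - a)"
  proof (rule poly_mapping_eqI)
    fix x
    have "m * Poly_Mapping.lookup a x + Poly_Mapping.lookup b x = m * Poly_Mapping.lookup e x"
      using arg_cong[OF e, of "\<lambda>p. Poly_Mapping.lookup p x"] by (simp add: lookup_add)
    then show "Poly_Mapping.lookup b x = Poly_Mapping.lookup (scale m (e - a)) x"
      by (simp add: lookup_minus diff_mult_distrib2)
  qed
  then show ?thesis by blast
qed

definition power_map :: "nat \<Rightarrow> (('x \<Rightarrow>\<^sub>0 nat) \<Rightarrow>\<^sub>0 'k::comm_ring_1) \<Rightarrow> (('x \<Rightarrow>\<^sub>0 nat) \<Rightarrow>\<^sub>0 'k)" where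
  "power_map m f =
     (\<Sum>a\<in>Poly_Mapping.keys f. Poly_Mapping.single (scale m a) (Poly_Mapping.lookup f a))"

definition root_map :: "nat \<Rightarrow> (('x \<Rightarrow>\<^sub>0 nat) \<Rightarrow>\<^sub>0 'k::comm_ring_1) \<Rightarrow> (('x \<Rightarrow>\<^sub>0 nat) \<Rightarrow>\<^sub>0 'k)" where
  "root_map m = Poly_Mapping.map_key (scale m)"

lemma power_map_superset:
  assumes "finite A" "Poly_Mapping.keys f \<subseteq> A"
  shows "power_map m f = (\<Sum>a\<in>A. Poly_Mapping.single (scale m a) (Poly_Mapping.lookup f a))"
  unfolding power_map_def using assms
  by (intro sum.mono_neutral_left) (auto simp: in_keys_iff)

lemma power_map_add: "power_map m (f + g) = power_map m f + power_map m g"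
proof -
  let ?A = "Poly_Mapping.keys f \<union> Poly_Mapping.keys g"
  have *: "power_map m h = (\<Sum>a\<in>?A. Poly_Mapping.single (scale m a) (Poly_Mapping.lookup h a))"
    if "Poly_Mapping.keys h \<subseteq> ?A" for h
    using that by (intro power_map_superset) auto
  show ?thesis
    using *[of f] *[of g] *[OF Poly_Mapping.keys_add]
    by (simp add: sum.distrib[symmetric] single_add[symmetric] lookup_add)
qed

lemma power_map_single: "power_map m (Poly_Mapping.single a c) = Poly_Mapping.single (scale m a) c"
  by (simp add: power_map_def)

lemma power_map_mult: "power_map m (f * g) = power_map m f * power_map m g"
proof (induction f rule: poly_mapping_add_induct)
  case (single a c)
  show ?case
    by (induction g rule: poly_mapping_add_induct)
      (auto simp: mult_single power_map_single scale_add power_map_add distrib_left)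
qed (auto simp: power_map_add distrib_right)

lemma power_map_0: "power_map m 0 = 0"
  by (simp add: power_map_def)

lemma power_map_1: "power_map m 1 = 1"
  using power_map_single[of m 0 1] by simp

lemma power_map_keys: "Poly_Mapping.keys (power_map m f) \<subseteq> scale m ` Poly_Mapping.keys f"
  unfolding power_map_def using Poly_Mapping.keys_sum by (force split: if_splits)

context
  fixes m :: nat
  assumes m: "m > 0"
begin

text \<open>The description of \<open>map_key\<close> is conditional on injectivity of the key map,
  which for \<open>scale m\<close> comes from m > 0.\<close>

lemma lookup_root_map:
  "Poly_Mapping.lookup (root_map m f) a = Poly_Mapping.lookup f (scale m a)"
  by (simp add: root_map_def Poly_Mapping.map_key.rep_eq[OF inj_scale[OF m]])

lemma root_map_add: "root_map m (f + g) = root_map m f + root_map m g"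
  by (rule poly_mapping_eqI) (simp add: lookup_root_map lookup_add)

lemma root_map_single:
  "root_map m (Poly_Mapping.single (scale m a) c) = Poly_Mapping.single a c"
  by (rule poly_mapping_eqI)
    (use inj_scale[OF m] in \<open>auto simp: lookup_root_map lookup_single when_def inj_def\<close>)

lemma root_map_single_0:
  "b \<notin> range (scale m) \<Longrightarrow> root_map m (Poly_Mapping.single b c) = 0"
  by (rule poly_mapping_eqI) (auto simp: lookup_root_map lookup_single when_def)

lemma root_map_power_map_mult: "root_map m (power_map m f * g) = f * root_map m g"
proof (induction f rule: poly_mapping_add_induct)
  case (single a c)
  show ?case
  proof (induction g rule: poly_mapping_add_induct)
    case (single b d)
    show ?case
    proof (cases "b \<in> range (scale m)")
      case True
      then show ?thesis
        by (auto simp: power_map_single mult_single root_map_single scale_add[symmetric])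
    next
      case False
      then have "scale m a + b \<notin> range (scale m)" using scale_add_in_range[OF m] by blast
      with False show ?thesis by (simp add: power_map_single mult_single root_map_single_0)
    qed
  qed (simp add: root_map_add distrib_left)
qed (simp add: root_map_add power_map_add distrib_right)

lemma root_map_1: "root_map m 1 = 1"
  using root_map_single[of 0 1] by simp

lemma root_map_power_map: "root_map m (power_map m f) = f"
  using root_map_power_map_mult[of f 1] by (simp add: root_map_1)

lemma root_map_keys: "a \<in> Poly_Mapping.keys (root_map m f) \<longleftrightarrow> scale m a \<in> Poly_Mapping.keys f"
  by (simp add: in_keys_iff lookup_root_map)

end

section \<open>Type-class rings as rings with carrier\<close>

lemma type_ring_simps [simp]:
  "carrier ring_of_type_algebra = (UNIV :: 'a::comm_ring_1 set)"
  "x \<otimes>\<^bsub>ring_of_type_algebra\<^esub> y = (x * y :: 'a)"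
  "x \<oplus>\<^bsub>ring_of_type_algebra\<^esub> y = (x + y :: 'a)"
  "\<one>\<^bsub>ring_of_type_algebra\<^esub> = (1 :: 'a)"
  "\<zero>\<^bsub>ring_of_type_algebra\<^esub> = (0 :: 'a)"
  by (simp_all add: ring_of_type_algebra_def)

interpretation type_ring: cring "ring_of_type_algebra :: 'a::comm_ring_1 ring"
  by (rule cring_from_type_algebra)

lemma type_ring_a_inv [simp]: "\<ominus>\<^bsub>ring_of_type_algebra\<^esub> x = - (x :: 'a::comm_ring_1)"
  by (rule type_ring.minus_equality) auto

lemma ideal_type_ring_iff: "ideal K (ring_of_type_algebra :: 'a::comm_ring_1 ring) \<longleftrightarrow> ideal_set K"
proof
  assume "ideal K (ring_of_type_algebra :: 'a ring)"
  then interpret ideal K "ring_of_type_algebra :: 'a ring" .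
  show "ideal_set K"
    using zero_closed additive_subgroup.zero_closed[OF is_additive_subgroup]
      additive_subgroup.a_closed[OF is_additive_subgroup] I_l_closed
    by (auto simp: ideal_set_def)
next
  assume K: "ideal_set K"
  show "ideal K (ring_of_type_algebra :: 'a ring)"
  proof (rule idealI)
    show "subgroup K (add_monoid (ring_of_type_algebra :: 'a ring))"
    proof (rule type_ring.add.subgroupI)
      show "\<ominus>\<^bsub>ring_of_type_algebra\<^esub> a \<in> K" if "a \<in> K" for a
        using ideal_setD(5)[OF K that] by simp
    qed (use ideal_setD[OF K] in auto)
  qed (use ideal_setD[OF K] in \<open>auto intro: type_ring.ring_axioms\<close>)
qed

lemma primeideal_type_ring_iff:
  "primeideal P (ring_of_type_algebra :: 'a::comm_ring_1 ring) \<longleftrightarrow> prime_set P"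
proof -
  have "P \<noteq> UNIV \<longleftrightarrow> 1 \<notin> P" if "ideal_set P"
    using ideal_setD(3)[OF that, of 1] by auto
  then show ?thesis
    unfolding primeideal_def primeideal_axioms_def prime_set_def ideal_type_ring_iff
    using type_ring.cring_axioms by (auto)
qed

lemma
  shows ideal_set_genideal: "ideal_set (Idl\<^bsub>ring_of_type_algebra\<^esub> (S :: 'a::comm_ring_1 set))"
    and genideal_self: "S \<subseteq> Idl\<^bsub>ring_of_type_algebra\<^esub> S"
    and genideal_least: "ideal_set K \<Longrightarrow> S \<subseteq> K \<Longrightarrow> Idl\<^bsub>ring_of_type_algebra\<^esub> S \<subseteq> K"
  using type_ring.genideal_ideal[of S] type_ring.genideal_self[of S] type_ring.genideal_minimal[of K S]
  by (simp_all add: ideal_type_ring_iff)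

abbreviation ideal_pow :: "'a::comm_ring_1 set \<Rightarrow> nat \<Rightarrow> 'a set" where
  "ideal_pow K n \<equiv> K [^]\<^bsub>ideals_set ring_of_type_algebra\<^esub> n"

interpretation type_ideals: comm_monoid "ideals_set (ring_of_type_algebra :: 'a::comm_ring_1 ring)"
  by (rule type_ring.ideals_set_is_comm_monoid)

lemma ideals_set_simps:
  "carrier (ideals_set (ring_of_type_algebra :: 'a::comm_ring_1 ring)) = {K. ideal_set K}"
  "K \<otimes>\<^bsub>ideals_set ring_of_type_algebra\<^esub> L = ideal_prod (ring_of_type_algebra :: 'a::comm_ring_1 ring) K L"
  by (simp_all add: ideals_set_def ideal_type_ring_iff)

lemma ideal_set_ideal_pow: "ideal_set K \<Longrightarrow> ideal_set (ideal_pow K n)"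
  using type_ideals.nat_pow_closed[of K n] by (simp add: ideals_set_simps)

lemma ideal_pow_add_mult:
  assumes "ideal_set K" "f \<in> ideal_pow K a" "g \<in> ideal_pow K b"
  shows "f * g \<in> ideal_pow K (a + b)"
proof -
  have "f \<otimes>\<^bsub>ring_of_type_algebra\<^esub> g \<in> ideal_prod ring_of_type_algebra (ideal_pow K a) (ideal_pow K b)"
    using assms(2,3) by (rule ideal_prod.prod)
  then show ?thesis
    using type_ideals.nat_pow_mult[of K a b] assms(1) by (simp add: ideals_set_simps)
qed

lemma ideal_pow_0: "ideal_pow K 0 = (UNIV :: 'a::comm_ring_1 set)"
  by (simp add: ideals_set_def)

lemma ideal_pow_1: "ideal_set K \<Longrightarrow> ideal_pow K 1 = K"
  using type_ideals.nat_pow_eone[of K] by (simp add: ideals_set_simps)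

lemma power_in_ideal_pow:
  assumes "ideal_set K" "f \<in> K"
  shows "f ^ e \<in> ideal_pow K e"
proof (induction e)
  case 0
  show ?case unfolding ideal_pow_0 by simp
next
  case (Suc e)
  then show ?case
    using ideal_pow_add_mult[OF assms(1), of f 1 "f ^ e" e] assms ideal_pow_1[OF assms(1)] by simp
qed

lemma prod_power_in_ideal_pow:
  assumes "ideal_set K" "finite A" "\<And>i. i \<in> A \<Longrightarrow> f i \<in> K"
  shows "(\<Prod>i\<in>A. f i ^ e i) \<in> ideal_pow K (sum e A)"
  using assms(2,3)
proof (induction A rule: finite_induct)
  case empty
  show ?case unfolding sum.empty ideal_pow_0 by simp
next
  case (insert i A)
  then show ?case
    using ideal_pow_add_mult[OF assms(1) power_in_ideal_pow[OF assms(1)], of "f i"] by simp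
qed

lemma ideal_pow_antimono:
  assumes "ideal_set K" "n \<le> N"
  shows "ideal_pow K N \<subseteq> ideal_pow K n"
proof -
  have "ideal_pow K (n + k) \<subseteq> ideal_pow K n" for k
  proof
    fix f assume "f \<in> ideal_pow K (n + k)"
    then have "f \<in> ideal_prod ring_of_type_algebra (ideal_pow K n) (ideal_pow K k)"
      using type_ideals.nat_pow_mult[of K n k] assms(1) by (simp add: ideals_set_simps)
    then show "f \<in> ideal_pow K n"
      by induction (use ideal_setD[OF ideal_set_ideal_pow[OF assms(1)]] in auto)
  qed
  from this[of "N - n"] show ?thesis using assms(2) by simp
qed


section \<open>Symbolic powers of squarefree monomial ideals\<close>

text \<open>The minimum of this degree over the exponents of a polynomial is its order of vanishing
  along the coordinate subspace cut out by the variables in \<open>F\<close>.\<close>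

definition weight :: "'x set \<Rightarrow> ('x \<Rightarrow>\<^sub>0 nat) \<Rightarrow> nat" where
  "weight F a = (\<Sum>x\<in>F. Poly_Mapping.lookup a x)"

text \<open>The \<open>n\<close>-th power of the prime generated by the variables in \<open>F\<close>.\<close>

definition face_power :: "'x set \<Rightarrow> nat \<Rightarrow> ('x::{finite,linorder}, 'k::field) mpoly set" where
  "face_power F n = {f. \<forall>a\<in>Poly_Mapping.keys f. n \<le> weight F a}"

lemma weight_add: "weight F (a + b) = weight F a + weight F b"
  by (simp add: weight_def lookup_add sum.distrib)

lemma weight_scale: "weight F (scale m a) = m * weight F a"
  by (simp add: weight_def sum_distrib_left)

lemma face_power_mult: "f \<in> face_power F a \<Longrightarrow> g \<in> face_power F b \<Longrightarrow> f * g \<in> face_power F (a + b)"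
  using keys_mult[of f g] by (fastforce simp: face_power_def weight_add intro: add_mono)

lemma face_power_0: "face_power F 0 = UNIV"
  by (auto simp: face_power_def)

lemma face_power_antimono: "n \<le> N \<Longrightarrow> face_power F N \<subseteq> face_power F n"
  by (auto simp: face_power_def)

lemma ideal_set_face_power: "ideal_set (face_power F n :: ('x::{finite,linorder}, 'k::field) mpoly set)"
  unfolding ideal_set_def
proof (intro conjI ballI allI)
  show "f + g \<in> face_power F n" if "f \<in> face_power F n" "g \<in> face_power F n" for f g :: "('x, 'k) mpoly"
    using that Poly_Mapping.keys_add[of f g] by (auto simp: face_power_def)
  show "r * f \<in> face_power F n" if "f \<in> face_power F n" for r f :: "('x, 'k) mpoly"
    using face_power_mult[of r F 0 f n] that by (simp add: face_power_0)
qed (simp add: face_power_def)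

lemma monomial_in_face_power: "monomial a \<in> face_power F n \<longleftrightarrow> n \<le> weight F a"
  by (simp add: face_power_def monomial_def)

lemma monomial_add: "monomial (a + b) = monomial a * monomial b"
  by (simp add: monomial_def mult_single)

lemma monomial_0: "monomial 0 = 1"
  by (simp add: monomial_def)

lemma monomial_power: "monomial a ^ e = monomial (scale e a)"
proof (induction e)
  case 0
  have "scale 0 a = 0" by (rule poly_mapping_eqI) simp
  then show ?case by (simp add: monomial_0)
next
  case (Suc e)
  have "scale (Suc e) a = a + scale e a" by (rule poly_mapping_eqI) (simp add: lookup_add)
  then show ?case using Suc by (simp add: monomial_add)
qed

lemma monomial_sum: "monomial (\<Sum>i\<in>A. a i) = (\<Prod>i\<in>A. monomial (a i))"
  by (induction A rule: infinite_finite_induct) (auto simp: monomial_0 monomial_add)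

text \<open>Compare the components of lowest weight.\<close>

lemma face_power_cancel:
  fixes s f :: "('x::{finite,linorder}, 'k::field) mpoly"
  assumes "s \<notin> face_power F 1" "s * f \<in> face_power F n"
  shows "f \<in> face_power F n"
  using assms(2)
proof (induction n)
  case 0
  then show ?case by (simp add: face_power_0)
next
  case (Suc n)
  define part :: "nat \<Rightarrow> ('x, 'k) mpoly \<Rightarrow> ('x, 'k) mpoly" where
    "part e h = (\<Sum>a\<in>{a\<in>Poly_Mapping.keys h. weight F a = e}. Poly_Mapping.single a (Poly_Mapping.lookup h a))"
    for e h
  have lookup_part: "Poly_Mapping.lookup (part e h) a = (if weight F a = e then Poly_Mapping.lookup h a else 0)"
    for e h a
    by (auto simp: part_def lookup_sum lookup_single when_def sum.If_cases in_keys_iff if_distrib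
        cong: if_cong)
  have part: "h - part e h \<in> face_power F (Suc e)" if "h \<in> face_power F e" for e h
    unfolding face_power_def
  proof clarify
    fix a assume "a \<in> Poly_Mapping.keys (h - part e h)"
    then have "a \<in> Poly_Mapping.keys h" "weight F a \<noteq> e"
      by (auto simp: in_keys_iff lookup_minus lookup_part split: if_splits)
    with that show "Suc e \<le> weight F a"
      by (fastforce simp: face_power_def)
  qed
  note I = ideal_setD[OF ideal_set_face_power[of F "Suc n"]]
  have f: "f \<in> face_power F n"
    using Suc face_power_antimono[of n "Suc n" F] by auto
  define s' where "s' = s - part 0 s"
  define f' where "f' = f - part n f"
  have s': "s' \<in> face_power F 1" and f': "f' \<in> face_power F (Suc n)"
    using part[of s 0] part[OF f] by (auto simp: s'_def f'_def face_power_0)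
  have "part 0 s * part n f = s * f - s' * f - part 0 s * f'"
    by (simp add: s'_def f'_def algebra_simps)
  moreover have "s' * f \<in> face_power F (Suc n)"
    using face_power_mult[OF s' f] by simp
  ultimately have "part 0 s * part n f \<in> face_power F (Suc n)"
    using Suc.prems f' I by metis
  moreover have "weight F a = n" if "a \<in> Poly_Mapping.keys (part 0 s * part n f)" for a
    using that keys_mult[of "part 0 s" "part n f"]
    by (fastforce simp: in_keys_iff lookup_part weight_add split: if_splits)
  \<comment> \<open>The product has only terms of weight \<open>n\<close>, yet all its terms have
    weight at least \<open>Suc n\<close>; so it vanishes, and one of its factors is 0. It cannot be
    \<open>part 0 s\<close>, as \<open>s\<close> would then lie in the prime.\<close>
  ultimately have "Poly_Mapping.keys (part 0 s * part n f) = {}"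
    by (fastforce simp: face_power_def)
  then have "part 0 s = 0 \<or> part n f = 0" by simp
  then show ?case
    using s' f' assms(1) by (auto simp: s'_def f'_def)
qed

text \<open>Primality is cancellation in the case n = 1.\<close>

lemma prime_set_face: "prime_set (face_power F 1 :: ('x::{finite,linorder}, 'k::field) mpoly set)"
  unfolding prime_set_def using face_power_cancel ideal_set_face_power
  by (auto simp: monomial_0[symmetric] monomial_in_face_power weight_def)

section \<open>Minimal primes of monomial ideals and contraction from their localizations\<close>

abbreviation variable :: "'x \<Rightarrow> ('x::{finite,linorder}, 'k::field) mpoly" where
  "variable x \<equiv> monomial (Poly_Mapping.single x 1)"

lemma weight_pos_iff: "weight F a \<ge> 1 \<longleftrightarrow> (\<exists>x\<in>F. Poly_Mapping.lookup a x \<noteq> 0)" for a :: "'x::finite \<Rightarrow>\<^sub>0 nat"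
  by (simp add: weight_def Suc_le_eq flip: neq0_conv)

lemma exponent_split: "a = (\<Sum>x\<in>UNIV. scale (Poly_Mapping.lookup a x) (Poly_Mapping.single x 1))"
  for a :: "'x::finite \<Rightarrow>\<^sub>0 nat"
  by (rule poly_mapping_eqI) (simp add: lookup_sum lookup_single when_def if_distrib cong: if_cong)

lemma monomial_prod: "monomial a = (\<Prod>x\<in>UNIV. variable x ^ Poly_Mapping.lookup a x)"
  using arg_cong[OF exponent_split, of monomial a] by (simp add: monomial_sum monomial_power)

lemma ideal_set_memI_monomials:
  fixes f :: "('x::{finite,linorder}, 'k::field) mpoly"
  assumes "ideal_set K" "\<And>a. a \<in> Poly_Mapping.keys f \<Longrightarrow> monomial a \<in> K"
  shows "f \<in> K"
proof -
  have "(\<Sum>a\<in>Poly_Mapping.keys f. Poly_Mapping.single a (Poly_Mapping.lookup f a)) \<in> K"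
  proof (rule ideal_set_sum[OF assms(1)])
    fix a assume "a \<in> Poly_Mapping.keys f"
    have "Poly_Mapping.single a (Poly_Mapping.lookup f a)
      = Poly_Mapping.single 0 (Poly_Mapping.lookup f a) * monomial a"
      by (simp add: monomial_def mult_single)
    also have "\<dots> \<in> K" using assms \<open>a \<in> _\<close> ideal_setD(3)[OF assms(1)] by blast
    finally show "Poly_Mapping.single a (Poly_Mapping.lookup f a) \<in> K" .
  qed
  then show ?thesis using poly_mapping_sum_single by metis
qed

lemma face_power_subset_prime:
  assumes "prime_set (P :: ('x::{finite,linorder}, 'k::field) mpoly set)" "\<And>x. x \<in> F \<Longrightarrow> variable x \<in> P"
  shows "face_power F 1 \<subseteq> P"
proof
  fix f :: "('x, 'k) mpoly" assume f: "f \<in> face_power F 1"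
  show "f \<in> P"
  proof (rule ideal_set_memI_monomials[OF prime_set_ideal[OF assms(1)]])
    fix a assume "a \<in> Poly_Mapping.keys f"
    then obtain x where x: "x \<in> F" "Poly_Mapping.lookup a x \<noteq> 0"
      using f unfolding face_power_def weight_pos_iff by blast
    have "variable x ^ Poly_Mapping.lookup a x \<in> P"
      using assms(2)[OF x(1)] x(2) by (simp add: prime_set_power_iff[OF assms(1)])
    moreover have "monomial a = variable x ^ Poly_Mapping.lookup a x *
        (\<Prod>x\<in>UNIV - {x}. variable x ^ Poly_Mapping.lookup a x :: ('x, 'k) mpoly)"
      unfolding monomial_prod[of a] by (rule prod.remove) auto
    ultimately show "monomial a \<in> P"
      using ideal_setD(4)[OF prime_set_ideal[OF assms(1)]] by simp
  qed
qed

lemma monomial_in_prime: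
  assumes "prime_set P" "monomial a \<in> P"
  shows "\<exists>x. Poly_Mapping.lookup a x \<noteq> 0 \<and> variable x \<in> P"
proof -
  have "(\<Prod>x\<in>UNIV. variable x ^ Poly_Mapping.lookup a x) \<in> P"
    by (simp only: monomial_prod[symmetric] assms(2))
  then obtain x where x: "variable x ^ Poly_Mapping.lookup a x \<in> P"
    using prime_set_prod[OF assms(1) finite] by blast
  then have "Poly_Mapping.lookup a x \<noteq> 0"
    using assms(1) by (auto simp: prime_set_def intro!: gr0I)
  with x show ?thesis
    using prime_set_power_iff[OF assms(1), of "Poly_Mapping.lookup a x"] by blast
qed

definition minimal_faces :: "('x::{finite,linorder}, 'k::field) mpoly set \<Rightarrow> 'x set set" where
  "minimal_faces I = {F. face_power F 1 \<in> minimal_primes mpoly_ring I}"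

text \<open>A prime P over a monomial ideal contains a variable of every generator. So the monomial
  prime on the variables in P already contains \<open>I\<close>, and it lies in P; minimality makes
  the two equal.\<close>

lemma minimal_primes_monomial:
  fixes I :: "('x::{finite,linorder}, 'k::field) mpoly set"
  assumes "I = Idl\<^bsub>mpoly_ring\<^esub> (monomial ` A)"
  shows "minimal_primes mpoly_ring I = (\<lambda>F. face_power F 1) ` minimal_faces I"
proof -
  have "\<exists>F. P = face_power F 1" if P: "P \<in> minimal_primes mpoly_ring I" for P
  proof -
    define F where "F = {x. variable x \<in> P}"
    have pr: "prime_set P" "I \<subseteq> P" and min: "\<And>Q. prime_set Q \<Longrightarrow> I \<subseteq> Q \<Longrightarrow> Q \<subseteq> P \<Longrightarrow> Q = P"
      using P by (auto simp: minimal_primes_def primeideal_type_ring_iff)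
    have "I \<subseteq> face_power F 1"
      unfolding assms
    proof (rule genideal_least[OF ideal_set_face_power], clarify)
      fix a assume "a \<in> A"
      then have "monomial a \<in> P" using pr(2) genideal_self[of "monomial ` A"] assms by blast
      then show "monomial a \<in> face_power F 1"
        using monomial_in_prime[OF pr(1)] unfolding monomial_in_face_power weight_pos_iff F_def by blast
    qed
    then have "face_power F 1 = P"
      using pr by (intro min prime_set_face face_power_subset_prime) (auto simp: F_def)
    then show ?thesis by blast
  qed
  then show ?thesis by (auto simp: minimal_faces_def)
qed

text \<open>Denominators are cleared: r/1 = a/s with a in J gives w s r = w a in J for some w
  outside P, and conversely r/1 = (s r)/s.\<close>

lemma local_contraction_eq:
  fixes J :: "'a::comm_ring_1 set"
  assumes "prime_set P" "ideal_set J"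
  shows "local_contraction ring_of_type_algebra P J = {r. \<exists>s. s \<notin> P \<and> s * r \<in> J}"
proof -
  let ?M = "self_module (ring_of_type_algebra :: 'a ring)"
  let ?fr = "fraction ring_of_type_algebra ?M (UNIV - P)"
  have rel: "((u, s), (v, t)) \<in> fraction_rel ring_of_type_algebra ?M (UNIV - P) \<longleftrightarrow>
      s \<notin> P \<and> t \<notin> P \<and> (\<exists>w. w \<notin> P \<and> w * t * u = w * s * v)" for u s v t
    by (auto simp: fraction_rel_def self_module_def)
  have one: "1 \<notin> P" using assms(1) by (simp add: prime_set_def)
  have "(\<exists>a s. ?fr r 1 = ?fr a s
      \<and> a \<in> J \<and> s \<notin> P) \<longleftrightarrow> (\<exists>s. s \<notin> P \<and> s * r \<in> J)" for r
  proof
    assume "\<exists>a s. ?fr r 1 = ?fr a s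
      \<and> a \<in> J \<and> s \<notin> P"
    then obtain a s where as: "?fr r 1 = ?fr a s"
      "a \<in> J" "s \<notin> P" by blast
    have "(r, 1) \<in> ?fr r 1"
      using one unfolding fraction_def Image_singleton_iff rel by blast
    then have "(r, 1) \<in> ?fr a s" unfolding as(1) .
    then have "\<exists>w. w \<notin> P \<and> w * 1 * a = w * s * r"
      unfolding fraction_def Image_singleton_iff rel by blast
    then obtain w where "w \<notin> P" "w * a = w * s * r" by auto
    then show "\<exists>s. s \<notin> P \<and> s * r \<in> J"
      using as(2,3) prime_set_mult_iff[OF assms(1)] ideal_setD(3)[OF assms(2)] by metis
  next
    assume "\<exists>s. s \<notin> P \<and> s * r \<in> J"
    then obtain s where s: "s \<notin> P" "s * r \<in> J" by blast
    have "(\<exists>w. w \<notin> P \<and> w * t * r = w * 1 * v) \<longleftrightarrow> (\<exists>w. w \<notin> P \<and> w * t * (s * r) = w * s * v)" for v t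
    proof
      assume "\<exists>w. w \<notin> P \<and> w * t * r = w * 1 * v"
      then obtain w where "w \<notin> P" "w * t * r = w * v" by auto
      then show "\<exists>w. w \<notin> P \<and> w * t * (s * r) = w * s * v"
        by (intro exI[of _ w]) (metis mult.assoc mult.commute)
    next
      assume "\<exists>w. w \<notin> P \<and> w * t * (s * r) = w * s * v"
      then obtain w where "w \<notin> P" "w * t * (s * r) = w * s * v" by auto
      then show "\<exists>w. w \<notin> P \<and> w * t * r = w * 1 * v"
        using s prime_set_mult_iff[OF assms(1)]
        by (intro exI[of _ "w * s"]) (auto simp: mult.assoc mult.left_commute[of s])
    qed
    then have "?fr r 1 = ?fr (s * r) s"
      using s one unfolding fraction_def by (auto simp: rel)
    with s show "\<exists>a s. ?fr r 1 = ?fr a s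
      \<and> a \<in> J \<and> s \<notin> P" by blast
  qed
  then show ?thesis by (auto simp: local_contraction_def Let_def)
qed

text \<open>
  By minimality of \<open>F\<close>, each \<open>x \<in> F\<close> is the only variable of \<open>F\<close> in some generator, which is
  squarefree; hence \<open>x\<close> times a unit of the localization lies in \<open>I\<close>.
\<close>

lemma local_contraction_ideal_pow:
  fixes I :: "('x::{finite,linorder}, 'k::field) mpoly set"
  assumes I: "I = Idl\<^bsub>mpoly_ring\<^esub> (monomial ` A)" and A: "\<And>a x. a \<in> A \<Longrightarrow> Poly_Mapping.lookup a x \<le> 1"
    and F: "F \<in> minimal_faces I"
  shows "local_contraction mpoly_ring (face_power F 1) (ideal_pow I n) = face_power F n"
proof -
  have idI: "ideal_set I" unfolding I by (rule ideal_set_genideal)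
  have gens: "monomial a \<in> I" if "a \<in> A" for a
    unfolding I using genideal_self that by (rule subsetD[OF _ imageI])
  have sub: "I \<subseteq> face_power F 1"
    and min: "\<And>Q. prime_set Q \<Longrightarrow> I \<subseteq> Q \<Longrightarrow> Q \<subseteq> face_power F 1 \<Longrightarrow> Q = face_power F 1"
    using F by (auto simp: minimal_faces_def minimal_primes_def primeideal_type_ring_iff)
  note idP = ideal_setD[OF ideal_set_ideal_pow[OF idI, of n]]
  have pow: "ideal_pow I n \<subseteq> face_power F n"
  proof (induction n)
    case (Suc n)
    have "f \<in> face_power F (Suc n)" if "f \<in> ideal_prod mpoly_ring (ideal_pow I n) I" for f
      using that
    proof induction
      case (prod f g)
      then show ?case using face_power_mult[of f F n g 1] Suc sub by auto
    qed (use ideal_setD(2)[OF ideal_set_face_power] in auto)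
    then show ?case by (auto simp: ideals_set_simps)
  qed (simp add: face_power_0)
  have gen: "\<exists>c\<in>A. \<forall>j\<in>F. Poly_Mapping.lookup c j = (if j = i then 1 else 0)" if i: "i \<in> F" for i
  proof (rule ccontr)
    assume contr: "\<not> ?thesis"
    \<comment> \<open>If no generator met \<open>F\<close> in \<open>i\<close> alone, each would
      contain another variable of \<open>F\<close>, and dropping \<open>i\<close> would leave a
      smaller prime over \<open>I\<close>.\<close>
    have "I \<subseteq> face_power (F - {i}) 1"
      unfolding I
    proof (rule genideal_least[OF ideal_set_face_power], clarify)
      fix a assume a: "a \<in> A"
      then have "(monomial a :: ('x, 'k) mpoly) \<in> face_power F 1"
        using gens sub by blast
      then obtain j where j: "j \<in> F" "Poly_Mapping.lookup a j \<noteq> 0"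
        unfolding monomial_in_face_power weight_pos_iff by blast
      obtain j' where "j' \<in> F" "Poly_Mapping.lookup a j' \<noteq> (if j' = i then 1 else 0)"
        using contr a by blast
      then have "\<exists>j\<in>F - {i}. Poly_Mapping.lookup a j \<noteq> 0"
        using A[OF a, of i] j by (cases "j' = i"; cases "j = i") auto
      then show "(monomial a :: ('x, 'k) mpoly) \<in> face_power (F - {i}) 1"
        unfolding monomial_in_face_power weight_pos_iff .
    qed
    moreover have "face_power (F - {i}) 1 \<subseteq> (face_power F 1 :: ('x, 'k) mpoly set)"
      unfolding face_power_def weight_pos_iff by blast
    ultimately have "face_power (F - {i}) 1 = (face_power F 1 :: ('x, 'k) mpoly set)"
      by (intro min prime_set_face)
    moreover have "variable i \<in> (face_power F 1 :: ('x, 'k) mpoly set)"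
      using i unfolding monomial_in_face_power weight_pos_iff by (intro bexI[of _ i]) auto
    ultimately have "variable i \<in> (face_power (F - {i}) 1 :: ('x, 'k) mpoly set)" by blast
    then show False
      unfolding monomial_in_face_power weight_pos_iff by (auto simp: lookup_single when_def split: if_splits)
  qed
  let ?L = "{r. \<exists>s. s \<notin> face_power F 1 \<and> s * r \<in> ideal_pow I n}"
  \<comment> \<open>\<open>?L\<close> is the contraction with denominators cleared. As it is an
    ideal, membership need only be tested on monomials.\<close>
  have "ideal_set ?L"
    unfolding ideal_set_def mem_Collect_eq
  proof (intro conjI ballI allI)
    show "\<exists>s. s \<notin> face_power F 1 \<and> s * 0 \<in> ideal_pow I n"
      using idP(1) prime_set_face[of F] by (auto simp: prime_set_def)
  next
    fix f g assume "f \<in> ?L" "g \<in> ?L"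
    then obtain s t where st: "s \<notin> face_power F 1" "t \<notin> face_power F 1"
      "s * f \<in> ideal_pow I n" "t * g \<in> ideal_pow I n" by blast
    have "s * t * (f + g) = t * (s * f) + s * (t * g)" by (simp add: algebra_simps)
    also have "\<dots> \<in> ideal_pow I n" using st idP by metis
    finally show "\<exists>s. s \<notin> face_power F 1 \<and> s * (f + g) \<in> ideal_pow I n"
      using st prime_set_mult_iff[OF prime_set_face] by blast
  next
    fix r f assume "f \<in> ?L"
    then obtain s where "s \<notin> face_power F 1" "s * f \<in> ideal_pow I n" by blast
    then show "\<exists>s. s \<notin> face_power F 1 \<and> s * (r * f) \<in> ideal_pow I n"
      using idP(3)[of "s * f" r] by (auto simp: mult.left_commute[of s r])
  qed
  have "?L = face_power F n"
  proof
    show "?L \<subseteq> face_power F n" using pow face_power_cancel by blast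
    show "face_power F n \<subseteq> ?L"
    proof
      fix f :: "('x, 'k) mpoly" assume f: "f \<in> face_power F n"
      show "f \<in> ?L"
      proof (rule ideal_set_memI_monomials[OF \<open>ideal_set ?L\<close>])
        fix a assume "a \<in> Poly_Mapping.keys f"
        then have a: "n \<le> weight F a" using f by (auto simp: face_power_def)
        obtain c where c: "\<And>i. i \<in> F \<Longrightarrow> c i \<in> A"
          "\<And>i j. i \<in> F \<Longrightarrow> j \<in> F \<Longrightarrow> Poly_Mapping.lookup (c i) j = (if j = i then 1 else 0)"
          using gen by metis
        \<comment> \<open>The exponent of the product of the generators \<open>c i\<close>, each
          taken as often as \<open>i\<close> occurs in \<open>a\<close>. There are
          \<open>weight F a\<close> factors, and \<open>E\<close> agrees with \<open>a\<close> on
          \<open>F\<close>.\<close>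
        define E where "E = (\<Sum>i\<in>F. scale (Poly_Mapping.lookup a i) (c i))"
        have E: "Poly_Mapping.lookup E j = Poly_Mapping.lookup a j" if "j \<in> F" for j
        proof -
          have "Poly_Mapping.lookup E j = (\<Sum>i\<in>F. if j = i then Poly_Mapping.lookup a i else 0)"
            unfolding E_def lookup_sum using c(2)[OF _ that] by (intro sum.cong) auto
          then show ?thesis using that by simp
        qed
        have "monomial E = (\<Prod>i\<in>F. monomial (c i) ^ Poly_Mapping.lookup a i)"
          by (simp add: E_def monomial_sum monomial_power)
        also have "\<dots> \<in> ideal_pow I (weight F a)"
          unfolding weight_def
          using c(1) gens by (intro prod_power_in_ideal_pow idI) auto
        finally have mE: "monomial E \<in> ideal_pow I n"
          using ideal_pow_antimono[OF idI a] by blast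
        \<comment> \<open>The part of \<open>E\<close> outside \<open>F\<close>. Its monomial avoids
          the prime and thus becomes a unit, while \<open>s + a\<close> dominates \<open>E\<close>
          everywhere.\<close>
        define s where "s = E - Poly_Mapping.mapp (\<lambda>x k. k when x \<in> F) E"
        have lookup_s: "Poly_Mapping.lookup s j = (if j \<in> F then 0 else Poly_Mapping.lookup E j)" for j
          by (auto simp: s_def lookup_minus lookup_mapp in_keys_iff when_def)
        have "s + a = (s + a - E) + E"
          by (rule poly_mapping_eqI) (simp add: lookup_add lookup_minus lookup_s E)
        then have "monomial s * monomial a = monomial (s + a - E) * (monomial E :: ('x, 'k) mpoly)"
          by (metis monomial_add)
        then have "monomial s * monomial a \<in> ideal_pow I n"
          using mE idP(3) by metis
        moreover have "(monomial s :: ('x, 'k) mpoly) \<notin> face_power F 1"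
          unfolding monomial_in_face_power weight_pos_iff by (simp add: lookup_s)
        ultimately show "monomial a \<in> ?L" by blast
      qed
    qed
  qed
  then show ?thesis
    using local_contraction_eq[OF prime_set_face ideal_set_ideal_pow[OF idI, of n], of F] by simp
qed

lemma symbolic_power_eq:
  fixes I :: "('x::{finite,linorder}, 'k::field) mpoly set"
  assumes "squarefree_monomial_ideal I"
  shows "symbolic_power mpoly_ring I n = (\<Inter>F\<in>minimal_faces I. face_power F n)"
proof -
  obtain A where A: "\<And>a x. a \<in> A \<Longrightarrow> Poly_Mapping.lookup a x \<le> 1" "I = Idl\<^bsub>mpoly_ring\<^esub> (monomial ` A)"
    using assms by (auto simp: squarefree_monomial_ideal_def)
  show ?thesis
    using local_contraction_ideal_pow[OF A(2,1)]
    by (auto simp: symbolic_power_def minimal_primes_monomial[OF A(2)])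
qed

lemma ideal_set_INT: "(\<And>i. i \<in> A \<Longrightarrow> ideal_set (K i)) \<Longrightarrow> ideal_set (\<Inter>i\<in>A. K i)"
  by (simp add: ideal_set_def)

lemma ideal_set_symbolic_power:
  fixes I :: "('x::{finite,linorder}, 'k::field) mpoly set"
  assumes "squarefree_monomial_ideal I"
  shows "ideal_set (symbolic_power mpoly_ring I n)"
  unfolding symbolic_power_eq[OF assms]
  by (rule ideal_set_INT) (rule ideal_set_face_power)

lemma power_map_face_power:
  assumes "f \<in> face_power F l" "n \<le> m * l"
  shows "power_map m f \<in> face_power F n"
  unfolding face_power_def
proof clarify
  fix b assume "b \<in> Poly_Mapping.keys (power_map m f)"
  then obtain a where a: "a \<in> Poly_Mapping.keys f" "b = scale m a"
    using power_map_keys by blast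
  then have "l \<le> weight F a" using assms(1) by (simp add: face_power_def)
  then have "m * l \<le> weight F b" by (simp add: a(2) weight_scale)
  with assms(2) show "n \<le> weight F b" by simp
qed

lemma power_map_symbolic_power:
  assumes "squarefree_monomial_ideal I" "n \<le> m * l"
  shows "power_map m ` symbolic_power mpoly_ring I l \<subseteq> symbolic_power mpoly_ring I n"
  unfolding symbolic_power_eq[OF assms(1)] using power_map_face_power[OF _ assms(2)] by blast

lemma root_map_symbolic_power:
  fixes I :: "('x::{finite,linorder}, 'k::field) mpoly set"
  assumes "squarefree_monomial_ideal I" "m > 0" "\<And>w. n \<le> m * w \<Longrightarrow> l \<le> w"
  shows "root_map m ` symbolic_power mpoly_ring I n \<subseteq> symbolic_power mpoly_ring I l"
proof -
  have "root_map m f \<in> face_power F l" if "f \<in> face_power F n" for F and f :: "('x, 'k) mpoly"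
    using that assms(3) by (auto simp: face_power_def root_map_keys[OF assms(2)] weight_scale[symmetric])
  then show ?thesis unfolding symbolic_power_eq[OF assms(1)] by blast
qed

lemma irrelevant_ideal_eq: "irrelevant_ideal = (face_power UNIV 1 :: ('x::{finite,linorder}, 'k::field) mpoly set)"
proof
  show "irrelevant_ideal \<subseteq> (face_power UNIV 1 :: ('x, 'k) mpoly set)"
    unfolding irrelevant_ideal_def
  proof (rule genideal_least[OF ideal_set_face_power], clarify)
    show "variable x \<in> (face_power UNIV 1 :: ('x, 'k) mpoly set)" for x
      unfolding monomial_in_face_power weight_pos_iff by (intro bexI[of _ x]) auto
  qed
  show "(face_power UNIV 1 :: ('x, 'k) mpoly set) \<subseteq> irrelevant_ideal"
  proof
    fix f :: "('x, 'k) mpoly" assume f: "f \<in> face_power UNIV 1"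
    show "f \<in> irrelevant_ideal"
      unfolding irrelevant_ideal_def
    proof (rule ideal_set_memI_monomials[OF ideal_set_genideal])
      fix a assume "a \<in> Poly_Mapping.keys f"
      then obtain x where x: "Poly_Mapping.lookup a x \<noteq> 0"
        using f unfolding face_power_def weight_pos_iff by blast
      have "a = (a - Poly_Mapping.single x 1) + Poly_Mapping.single x 1"
        using x by (intro poly_mapping_eqI) (auto simp: lookup_add lookup_minus lookup_single when_def)
      then have "monomial a = monomial (a - Poly_Mapping.single x 1) * (variable x :: ('x, 'k) mpoly)"
        by (metis monomial_add)
      moreover have "monomial (a - Poly_Mapping.single x 1) * variable x
          \<in> Idl\<^bsub>mpoly_ring\<^esub> (range (variable :: 'x \<Rightarrow> ('x, 'k) mpoly))"
        by (rule ideal_setD(3)[OF ideal_set_genideal subsetD[OF genideal_self]]) simp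
      ultimately show "monomial a \<in> Idl\<^bsub>mpoly_ring\<^esub> (range (variable :: 'x \<Rightarrow> ('x, 'k) mpoly))"
        by simp
    qed
  qed
qed

text \<open>This supplies properness for regular sequences in \<mm>. A symbolic power other than the
  whole ring is an intersection over at least one face, and n > 0 places the corresponding power
  inside \<mm>.\<close>

lemma symbolic_power_subset_irrelevant_ideal:
  fixes I :: "('x::{finite,linorder}, 'k::field) mpoly set"
  assumes "squarefree_monomial_ideal I" "n > 0" "symbolic_power mpoly_ring I n \<noteq> UNIV"
  shows "symbolic_power mpoly_ring I n \<subseteq> irrelevant_ideal"
proof -
  obtain F where "F \<in> minimal_faces I"
    using assms(3) symbolic_power_eq[OF assms(1)] by auto
  moreover have "face_power F n \<subseteq> (face_power UNIV 1 :: ('x, 'k) mpoly set)"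
  proof -
    have "face_power F n \<subseteq> (face_power F 1 :: ('x, 'k) mpoly set)"
      using assms(2) by (intro face_power_antimono) simp
    also have "\<dots> \<subseteq> face_power UNIV 1"
      unfolding face_power_def weight_pos_iff by blast
    finally show ?thesis .
  qed
  ultimately show ?thesis
    unfolding irrelevant_ideal_eq symbolic_power_eq[OF assms(1)] by blast
qed

section \<open>Quotients of a ring as modules\<close>

lemma r_coset_eq_image: "K +>\<^bsub>ring_of_type_algebra\<^esub> u = (\<lambda>h. h + u) ` (K :: 'a::comm_ring_1 set)"
  by (auto simp: a_r_coset_def')

context
  fixes K :: "'a::comm_ring_1 set"
  assumes K: "ideal_set K"
begin

lemma coset_eq_iff: "K +>\<^bsub>ring_of_type_algebra\<^esub> u = K +>\<^bsub>ring_of_type_algebra\<^esub> v \<longleftrightarrow> u - v \<in> K"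
proof
  assume "K +>\<^bsub>ring_of_type_algebra\<^esub> u = K +>\<^bsub>ring_of_type_algebra\<^esub> v"
  moreover have "u \<in> K +>\<^bsub>ring_of_type_algebra\<^esub> u"
    using ideal_setD(1)[OF K] by (force simp: r_coset_eq_image)
  ultimately show "u - v \<in> K" by (auto simp: r_coset_eq_image)
next
  assume uv: "u - v \<in> K"
  show "K +>\<^bsub>ring_of_type_algebra\<^esub> u = K +>\<^bsub>ring_of_type_algebra\<^esub> v"
    unfolding r_coset_eq_image
  proof (intro equalityI image_subsetI)
    fix h assume h: "h \<in> K"
    show "h + u \<in> (\<lambda>h. h + v) ` K"
      using ideal_setD(2)[OF K h uv] by (intro image_eqI[of _ _ "h + (u - v)"]) auto
    show "h + v \<in> (\<lambda>h. h + u) ` K"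
      using ideal_setD(6)[OF K h uv] by (intro image_eqI[of _ _ "h - (u - v)"]) auto
  qed
qed

lemma quot_module_simps:
  "carrier (quot_module ring_of_type_algebra K) = range (\<lambda>u. K +>\<^bsub>ring_of_type_algebra\<^esub> u)"
  "\<zero>\<^bsub>quot_module ring_of_type_algebra K\<^esub> = K +>\<^bsub>ring_of_type_algebra\<^esub> 0"
  "(K +>\<^bsub>ring_of_type_algebra\<^esub> u) \<oplus>\<^bsub>quot_module ring_of_type_algebra K\<^esub> (K +>\<^bsub>ring_of_type_algebra\<^esub> v)
     = K +>\<^bsub>ring_of_type_algebra\<^esub> (u + v)"
  "r \<odot>\<^bsub>quot_module ring_of_type_algebra K\<^esub> (K +>\<^bsub>ring_of_type_algebra\<^esub> u)
     = K +>\<^bsub>ring_of_type_algebra\<^esub> (r * u)"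
proof -
  interpret ideal K "ring_of_type_algebra :: 'a ring"
    using K by (simp add: ideal_type_ring_iff)
  show "carrier (quot_module ring_of_type_algebra K) = range (\<lambda>u. K +>\<^bsub>ring_of_type_algebra\<^esub> u)"
    by (auto simp: quot_module_def FactRing_def A_RCOSETS_def')
  show "\<zero>\<^bsub>quot_module ring_of_type_algebra K\<^esub> = K +>\<^bsub>ring_of_type_algebra\<^esub> 0"
    by (simp add: quot_module_def FactRing_def r_coset_eq_image)
  show "(K +>\<^bsub>ring_of_type_algebra\<^esub> u) \<oplus>\<^bsub>quot_module ring_of_type_algebra K\<^esub> (K +>\<^bsub>ring_of_type_algebra\<^esub> v)
     = K +>\<^bsub>ring_of_type_algebra\<^esub> (u + v)"
    using a_rcos_sum[of u v] by (simp add: quot_module_def FactRing_def)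
  show "r \<odot>\<^bsub>quot_module ring_of_type_algebra K\<^esub> (K +>\<^bsub>ring_of_type_algebra\<^esub> u)
     = K +>\<^bsub>ring_of_type_algebra\<^esub> (r * u)"
    using rcoset_mult_add[of r u] by (simp add: quot_module_def FactRing_def)
qed

lemma module_quot_module: "module ring_of_type_algebra (quot_module ring_of_type_algebra K)"
proof (rule moduleI)
  show "abelian_group (quot_module ring_of_type_algebra K)"
  proof (rule abelian_groupI)
    fix A assume "A \<in> carrier (quot_module ring_of_type_algebra K)"
    then obtain u where A: "A = K +>\<^bsub>ring_of_type_algebra\<^esub> u" by (auto simp: quot_module_simps)
    show "\<exists>B\<in>carrier (quot_module ring_of_type_algebra K).
        B \<oplus>\<^bsub>quot_module ring_of_type_algebra K\<^esub> A = \<zero>\<^bsub>quot_module ring_of_type_algebra K\<^esub>"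
      by (intro bexI[of _ "K +>\<^bsub>ring_of_type_algebra\<^esub> (- u)"]) (simp_all add: A quot_module_simps)
  qed (auto simp: quot_module_simps algebra_simps)
qed (auto simp: quot_module_simps algebra_simps intro: type_ring.cring_axioms)

lemma finsum_quot_module:
  "(\<Oplus>\<^bsub>quot_module ring_of_type_algebra K\<^esub>k\<in>{..<n::nat}. K +>\<^bsub>ring_of_type_algebra\<^esub> w k)
     = K +>\<^bsub>ring_of_type_algebra\<^esub> (\<Sum>k<n. w k)"
proof -
  interpret M: module "ring_of_type_algebra :: 'a ring" "quot_module ring_of_type_algebra K"
    by (rule module_quot_module)
  show ?thesis
  proof (induction n)
    case 0
    then show ?case by (simp add: quot_module_simps)
  next
    case (Suc n)
    have "(\<Oplus>\<^bsub>quot_module ring_of_type_algebra K\<^esub>k\<in>insert n {..<n}. K +>\<^bsub>ring_of_type_algebra\<^esub> w k)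
      = (K +>\<^bsub>ring_of_type_algebra\<^esub> w n) \<oplus>\<^bsub>quot_module ring_of_type_algebra K\<^esub>
        (\<Oplus>\<^bsub>quot_module ring_of_type_algebra K\<^esub>k\<in>{..<n}. K +>\<^bsub>ring_of_type_algebra\<^esub> w k)"
      by (rule M.finsum_insert) (auto simp: quot_module_simps)
    then show ?case by (simp add: Suc lessThan_Suc quot_module_simps add.commute)
  qed
qed

end

section \<open>Regular sequences on R/K in terms of ideals of R\<close>

lemma ideal_set_foldl_adjoin: "ideal_set K \<Longrightarrow> ideal_set (foldl adjoin K fs)"
  by (induction fs arbitrary: K) (auto simp: ideal_set_adjoin)

lemma foldl_adjoin_superset: "K \<subseteq> foldl adjoin K fs"
proof (induction fs arbitrary: K)
  case (Cons f fs)
  then show ?case using adjoin_superset[of K f] by (force simp: subset_iff)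
qed simp

lemma foldl_adjoin_subset:
  "ideal_set L \<Longrightarrow> K \<subseteq> L \<Longrightarrow> set fs \<subseteq> L \<Longrightarrow> foldl adjoin K fs \<subseteq> L"
  by (induction fs arbitrary: K) (auto simp: adjoin_subset)

lemma foldl_adjoin_eq:
  "foldl adjoin K fs = {k + (\<Sum>i<length fs. fs ! i * w i) | k w. k \<in> K}"
proof (induction fs rule: rev_induct)
  case (snoc f fs)
  have "adjoin {k + (\<Sum>i<length fs. fs ! i * w i) | k w. k \<in> K} f
    = {k + (\<Sum>i<length (fs @ [f]). (fs @ [f]) ! i * w i) | k w. k \<in> K}" (is "?L = ?R")
  proof (intro equalityI subsetI)
    fix x assume "x \<in> ?L"
    then obtain k w r where k: "k \<in> K" and x: "x = k + (\<Sum>i<length fs. fs ! i * w i) + r * f"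
      by (auto simp: adjoin_def)
    define w' where "w' = w(length fs := r)"
    have "x = k + (\<Sum>i<length (fs @ [f]). (fs @ [f]) ! i * w' i)"
      by (simp add: x nth_append w'_def algebra_simps)
    then show "x \<in> ?R" using k by blast
  next
    fix x assume "x \<in> ?R"
    then obtain k w where k: "k \<in> K" and x: "x = k + (\<Sum>i<length (fs @ [f]). (fs @ [f]) ! i * w i)"
      by blast
    have "x = (k + (\<Sum>i<length fs. fs ! i * w i)) + w (length fs) * f"
      by (simp add: x nth_append algebra_simps)
    then show "x \<in> ?L" using k by (auto simp: adjoin_def)
  qed
  then show ?case using snoc by simp
qed simp

text \<open>Coefficients in R/K lift to R, which turns a combination of the sequence into the coset
  of a combination in R; the summand from \<open>K\<close> disappears in the quotient.\<close>

lemma seq_submodule_quot_module: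
  assumes "ideal_set (K :: 'a::comm_ring_1 set)"
  shows "seq_submodule (quot_module ring_of_type_algebra K) fs
    = (\<lambda>u. K +>\<^bsub>ring_of_type_algebra\<^esub> u) ` foldl adjoin K fs"
proof (intro equalityI subsetI)
  fix A assume "A \<in> seq_submodule (quot_module ring_of_type_algebra K) fs"
  then obtain u where u: "u \<in> {..<length fs} \<rightarrow> carrier (quot_module ring_of_type_algebra K)"
    and A: "A = (\<Oplus>\<^bsub>quot_module ring_of_type_algebra K\<^esub>k\<in>{..<length fs}.
        fs ! k \<odot>\<^bsub>quot_module ring_of_type_algebra K\<^esub> u k)"
    by (auto simp: seq_submodule_def)
  interpret M: module "ring_of_type_algebra :: 'a ring" "quot_module ring_of_type_algebra K"
    by (rule module_quot_module[OF assms])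
  have "\<forall>k. \<exists>w. k < length fs \<longrightarrow> u k = K +>\<^bsub>ring_of_type_algebra\<^esub> w"
    using u by (fastforce simp: quot_module_simps[OF assms])
  then obtain w where w: "\<And>k. k < length fs \<Longrightarrow> u k = K +>\<^bsub>ring_of_type_algebra\<^esub> w k" by metis
  have "A = (\<Oplus>\<^bsub>quot_module ring_of_type_algebra K\<^esub>k\<in>{..<length fs}. K +>\<^bsub>ring_of_type_algebra\<^esub> (fs ! k * w k))"
    unfolding A by (rule M.finsum_cong') (auto simp: w quot_module_simps[OF assms])
  also have "\<dots> = K +>\<^bsub>ring_of_type_algebra\<^esub> (\<Sum>k<length fs. fs ! k * w k)"
    by (rule finsum_quot_module[OF assms])
  also have "\<dots> = K +>\<^bsub>ring_of_type_algebra\<^esub> (0 + (\<Sum>k<length fs. fs ! k * w k))" by simp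
  finally show "A \<in> (\<lambda>u. K +>\<^bsub>ring_of_type_algebra\<^esub> u) ` foldl adjoin K fs"
    unfolding foldl_adjoin_eq using ideal_setD(1)[OF assms] by blast
next
  fix A assume "A \<in> (\<lambda>u. K +>\<^bsub>ring_of_type_algebra\<^esub> u) ` foldl adjoin K fs"
  then obtain k w where k: "k \<in> K" and A: "A = K +>\<^bsub>ring_of_type_algebra\<^esub> (k + (\<Sum>i<length fs. fs ! i * w i))"
    unfolding foldl_adjoin_eq by blast
  interpret M: module "ring_of_type_algebra :: 'a ring" "quot_module ring_of_type_algebra K"
    by (rule module_quot_module[OF assms])
  have "A = K +>\<^bsub>ring_of_type_algebra\<^esub> (\<Sum>i<length fs. fs ! i * w i)"
    unfolding A coset_eq_iff[OF assms] using k by simp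
  also have "\<dots> = (\<Oplus>\<^bsub>quot_module ring_of_type_algebra K\<^esub>k\<in>{..<length fs}. K +>\<^bsub>ring_of_type_algebra\<^esub> (fs ! k * w k))"
    by (rule finsum_quot_module[OF assms, symmetric])
  also have "\<dots> = (\<Oplus>\<^bsub>quot_module ring_of_type_algebra K\<^esub>k\<in>{..<length fs}.
        fs ! k \<odot>\<^bsub>quot_module ring_of_type_algebra K\<^esub> (K +>\<^bsub>ring_of_type_algebra\<^esub> w k))"
    by (simp add: quot_module_simps[OF assms])
  finally show "A \<in> seq_submodule (quot_module ring_of_type_algebra K) fs"
    unfolding seq_submodule_def
    by (auto simp: quot_module_simps[OF assms] intro!: exI[of _ "\<lambda>k. K +>\<^bsub>ring_of_type_algebra\<^esub> w k"])
qed

lemma coset_in_seq_submodule: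
  assumes "ideal_set (K :: 'a::comm_ring_1 set)"
  shows "K +>\<^bsub>ring_of_type_algebra\<^esub> u \<in> seq_submodule (quot_module ring_of_type_algebra K) fs
    \<longleftrightarrow> u \<in> foldl adjoin K fs"
proof -
  have "u \<in> foldl adjoin K fs" if "u - v \<in> K" "v \<in> foldl adjoin K fs" for v
    using ideal_setD(2)[OF ideal_set_foldl_adjoin[OF assms], of "u - v" fs v]
      foldl_adjoin_superset[of K fs] that by auto
  then show ?thesis
    by (auto simp: seq_submodule_quot_module[OF assms] coset_eq_iff[OF assms])
qed

lemma regular_seq_mod_iff_nth:
  "regular_seq_mod K fs \<longleftrightarrow> (\<forall>k<length fs. regular_mod (foldl adjoin K (take k fs)) (fs ! k))"
proof (induction fs arbitrary: K)
  case (Cons f fs)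
  then show ?case by (simp add: All_less_Suc2)
qed simp

lemma regular_sequence_quot_module:
  assumes "ideal_set (K :: 'a::comm_ring_1 set)"
  shows "regular_sequence (quot_module ring_of_type_algebra K) fs
    \<longleftrightarrow> regular_seq_mod K fs \<and> foldl adjoin K fs \<noteq> UNIV"
proof -
  have "seq_submodule (quot_module ring_of_type_algebra K) fs = carrier (quot_module ring_of_type_algebra K)
    \<longleftrightarrow> foldl adjoin K fs = UNIV"
    using coset_in_seq_submodule[OF assms] seq_submodule_quot_module[OF assms]
      quot_module_simps(1)[OF assms] by (metis UNIV_I UNIV_eq_I rangeI)
  then show ?thesis
    unfolding regular_sequence_def regular_seq_mod_iff_nth regular_mod_def
    by (simp add: quot_module_simps[OF assms] coset_in_seq_submodule[OF assms])
qed

lemma carrier_quot_module_trivial_iff: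
  assumes "ideal_set (K :: 'a::comm_ring_1 set)"
  shows "carrier (quot_module ring_of_type_algebra K) = {\<zero>\<^bsub>quot_module ring_of_type_algebra K\<^esub>}
    \<longleftrightarrow> K = UNIV"
proof -
  have "carrier (quot_module ring_of_type_algebra K) = {\<zero>\<^bsub>quot_module ring_of_type_algebra K\<^esub>}
    \<longleftrightarrow> (\<forall>u. K +>\<^bsub>ring_of_type_algebra\<^esub> u = K +>\<^bsub>ring_of_type_algebra\<^esub> 0)"
    by (auto simp: quot_module_simps[OF assms])
  then show ?thesis by (auto simp: coset_eq_iff[OF assms])
qed


section \<open>Depth\<close>

lemma power_map_monomial: "power_map m (monomial a) = monomial a ^ m"
  by (simp add: monomial_power) (simp add: monomial_def power_map_single)

text \<open>\<phi> sends each variable to its \<open>m\<close>-th power, and a prime containing that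
  power contains the variable.\<close>

lemma irrelevant_ideal_subset_prime:
  fixes Q :: "('x::{finite,linorder}, 'k::field) mpoly set"
  assumes "prime_set Q" "m > 0" "power_map m ` irrelevant_ideal \<subseteq> Q"
  shows "irrelevant_ideal \<subseteq> Q"
  unfolding irrelevant_ideal_eq
proof (rule face_power_subset_prime[OF assms(1)])
  fix x
  have "(variable x :: ('x, 'k) mpoly) \<in> irrelevant_ideal"
    unfolding irrelevant_ideal_def by (rule subsetD[OF genideal_self]) simp
  then have "power_map m (variable x) \<in> Q" using assms(3) by blast
  then show "variable x \<in> Q"
    by (simp add: power_map_monomial prime_set_power_iff[OF assms(1,2)])
qed

lemma depth_quot_module_le:
  fixes J K :: "('x::{finite,linorder}, 'k::field) mpoly set"
  assumes J: "ideal_set J" and K: "ideal_set K" and m: "m > 0"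
    and phi: "power_map m ` K \<subseteq> J" and psi: "root_map m ` J \<subseteq> K"
    and sub: "K \<noteq> UNIV \<Longrightarrow> K \<subseteq> irrelevant_ideal"
  shows "depth irrelevant_ideal (quot_module mpoly_ring J) \<le> depth irrelevant_ideal (quot_module mpoly_ring K)"
proof (cases "K = UNIV")
  case True
  then show ?thesis using carrier_quot_module_trivial_iff[OF K] by (simp add: depth_def)
next
  case False
  \<comment> \<open>Since \<psi>(1) = 1, properness of \<open>K\<close> passes to \<open>J\<close>,
    so neither depth falls under the convention for the zero module.\<close>
  have "1 \<notin> J"
  proof
    assume "1 \<in> J"
    then have "1 \<in> K" using psi root_map_1[OF m, where 'a = 'x and 'b = 'k] by (metis image_subset_iff)
    then show False using ideal_setD(3)[OF K, of 1] False by auto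
  qed
  then have "J \<noteq> UNIV" by blast
  have "\<exists>gs. length gs = length fs \<and> set gs \<subseteq> irrelevant_ideal \<and> regular_sequence (quot_module mpoly_ring K) gs"
    if fs: "set fs \<subseteq> irrelevant_ideal" "regular_sequence (quot_module mpoly_ring J) fs" for fs
  proof -
    have idm: "ideal_set (irrelevant_ideal :: ('x, 'k) mpoly set)"
      unfolding irrelevant_ideal_eq by (rule ideal_set_face_power)
    have pm: "power_map m f \<in> irrelevant_ideal" if "f \<in> irrelevant_ideal" for f :: "('x, 'k) mpoly"
      using that m unfolding irrelevant_ideal_eq by (rule_tac power_map_face_power) auto
    have "regular_seq_mod J fs" using fs(2) by (simp add: regular_sequence_quot_module[OF J])
    then obtain gs where gs: "length gs = length fs" "set gs \<subseteq> irrelevant_ideal"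
      "regular_seq_mod J (map (power_map m) gs)"
      using mpoly.regular_seq_mod_in_image[OF idm power_map_0 power_map_1 power_map_add power_map_mult
          pm irrelevant_ideal_subset_prime[OF _ m] J _ fs(1)] by blast
    have "regular_seq_mod K gs"
      using power_map_add power_map_mult root_map_add[OF m] root_map_power_map_mult[OF m]
        root_map_power_map[OF m] phi psi gs(3)
      by (rule regular_seq_mod_retract)
    moreover have "foldl adjoin K gs \<subseteq> irrelevant_ideal"
      using sub[OF False] gs(2) unfolding irrelevant_ideal_eq
      by (intro foldl_adjoin_subset ideal_set_face_power)
    moreover have "irrelevant_ideal \<noteq> (UNIV :: ('x, 'k) mpoly set)"
      using prime_set_face[of UNIV] unfolding irrelevant_ideal_eq by (auto simp: prime_set_def)
    ultimately show ?thesis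
      using gs(1,2) by (auto simp: regular_sequence_quot_module[OF K])
  qed
  then have "{enat (length fs) | fs. set fs \<subseteq> irrelevant_ideal \<and> regular_sequence (quot_module mpoly_ring J) fs}
    \<subseteq> {enat (length fs) | fs. set fs \<subseteq> irrelevant_ideal \<and> regular_sequence (quot_module mpoly_ring K) fs}"
    by (smt (verit) Collect_mono)
  then show ?thesis
    using \<open>J \<noteq> UNIV\<close> False
    by (simp add: depth_def carrier_quot_module_trivial_iff[OF J] carrier_quot_module_trivial_iff[OF K] Sup_subset_mono)
qed

section \<open>Localizations and the maps between them\<close>

locale localized_module =
  module "ring_of_type_algebra :: 'r::comm_ring_1 ring" M for M :: "('r::comm_ring_1, 'm, 'b) module_scheme" +
  fixes W :: "'r set"
  assumes one_W: "1 \<in> W" and mult_W: "s \<in> W \<Longrightarrow> t \<in> W \<Longrightarrow> s * t \<in> W"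
begin

abbreviation fr :: "'m \<Rightarrow> 'r \<Rightarrow> ('m \<times> 'r) set" where
  "fr u s \<equiv> fraction ring_of_type_algebra M W u s"

abbreviation L where
  "L \<equiv> localization ring_of_type_algebra M W"

lemma smult_mult: "x \<in> carrier M \<Longrightarrow> a \<odot>\<^bsub>M\<^esub> (b \<odot>\<^bsub>M\<^esub> x) = (a * b) \<odot>\<^bsub>M\<^esub> x"
  using smult_assoc1[of a b x] by simp

lemma smult_one': "x \<in> carrier M \<Longrightarrow> 1 \<odot>\<^bsub>M\<^esub> x = x"
  using smult_one[of x] by simp

lemma smult_add: "x \<in> carrier M \<Longrightarrow> y \<in> carrier M \<Longrightarrow> a \<odot>\<^bsub>M\<^esub> (x \<oplus>\<^bsub>M\<^esub> y) = a \<odot>\<^bsub>M\<^esub> x \<oplus>\<^bsub>M\<^esub> a \<odot>\<^bsub>M\<^esub> y"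
  using smult_r_distr[of a x y] by simp

definition frel :: "'m \<Rightarrow> 'r \<Rightarrow> 'm \<Rightarrow> 'r \<Rightarrow> bool" where
  "frel u s v t \<longleftrightarrow> (\<exists>w\<in>W. (w * t) \<odot>\<^bsub>M\<^esub> u = (w * s) \<odot>\<^bsub>M\<^esub> v)"

lemma frel_sym: "frel u s v t \<Longrightarrow> frel v t u s"
  unfolding frel_def by metis

lemma frel_trans:
  assumes "frel u s v t" "frel v t x r" "u \<in> carrier M" "v \<in> carrier M" "x \<in> carrier M" "t \<in> W"
  shows "frel u s x r"
proof -
  obtain w w' where w: "w \<in> W" "(w * t) \<odot>\<^bsub>M\<^esub> u = (w * s) \<odot>\<^bsub>M\<^esub> v"
    and w': "w' \<in> W" "(w' * r) \<odot>\<^bsub>M\<^esub> v = (w' * t) \<odot>\<^bsub>M\<^esub> x"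
    using assms(1,2) by (auto simp: frel_def)
  have "(w * w' * t * r) \<odot>\<^bsub>M\<^esub> u = (w' * r) \<odot>\<^bsub>M\<^esub> ((w * t) \<odot>\<^bsub>M\<^esub> u)"
    using assms by (simp add: smult_mult mult.commute mult.left_commute)
  also have "\<dots> = (w * s) \<odot>\<^bsub>M\<^esub> ((w' * r) \<odot>\<^bsub>M\<^esub> v)"
    unfolding w(2) using assms by (simp add: smult_mult mult.commute mult.left_commute)
  also have "\<dots> = (w * w' * t * s) \<odot>\<^bsub>M\<^esub> x"
    unfolding w'(2) using assms by (simp add: smult_mult mult.commute mult.left_commute)
  finally show ?thesis
    using w(1) w'(1) assms(6) mult_W unfolding frel_def by blast
qed

lemma fr_mem:
  assumes "u \<in> carrier M" "s \<in> W"
  shows "(v, t) \<in> fr u s \<longleftrightarrow> v \<in> carrier M \<and> t \<in> W \<and> frel u s v t"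
  using assms by (auto simp: fraction_def fraction_rel_def frel_def)

lemma fr_eq_iff:
  assumes "u \<in> carrier M" "s \<in> W" "v \<in> carrier M" "t \<in> W"
  shows "fr u s = fr v t \<longleftrightarrow> frel u s v t"
proof
  assume "fr u s = fr v t"
  moreover have "(v, t) \<in> fr v t" using assms one_W by (auto simp: fr_mem frel_def)
  ultimately show "frel u s v t" using assms by (simp add: fr_mem flip: \<open>fr u s = fr v t\<close>)
next
  assume rel: "frel u s v t"
  have "frel u s x r \<longleftrightarrow> frel v t x r" if "x \<in> carrier M" for x r
    using frel_trans[OF frel_sym[OF rel], of x r] frel_trans[OF rel, of x r] assms that by blast
  then show "fr u s = fr v t"
    using assms by (auto simp: fr_mem)
qed

lemma fr_eqI:
  assumes "u \<in> carrier M" "s \<in> W" "v \<in> carrier M" "t \<in> W" "t \<odot>\<^bsub>M\<^esub> u = s \<odot>\<^bsub>M\<^esub> v"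
  shows "fr u s = fr v t"
  using assms one_W by (auto simp: fr_eq_iff frel_def intro: bexI[of _ 1])

lemma fr_cancel:
  assumes "u \<in> carrier M" "s \<in> W" "t \<in> W"
  shows "fr (t \<odot>\<^bsub>M\<^esub> u) (t * s) = fr u s"
  using assms by (intro fr_eqI) (simp_all add: smult_mult mult_W mult.commute)

text \<open>Operations on fractions are unions over representatives; this collapses such a union
  once its terms do not depend on the representative.\<close>

lemma fr_UN:
  assumes "u \<in> carrier M" "s \<in> W"
    and "\<And>v t. v \<in> carrier M \<Longrightarrow> t \<in> W \<Longrightarrow> frel u s v t \<Longrightarrow> g (v, t) = g (u, s)"
  shows "(\<Union>p\<in>fr u s. g p) = g (u, s)"
proof -
  have "(u, s) \<in> fr u s" using assms(1,2) one_W by (auto simp: fr_mem frel_def)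
  moreover have "g p = g (u, s)" if "p \<in> fr u s" for p
    using that assms by (cases p) (auto simp: fr_mem)
  ultimately show ?thesis by blast
qed

lemma carrier_L: "carrier L = {fr u s | u s. u \<in> carrier M \<and> s \<in> W}"
  by (simp add: localization_def)

lemma fr_closed: "u \<in> carrier M \<Longrightarrow> s \<in> W \<Longrightarrow> fr u s \<in> carrier L"
  unfolding carrier_L by blast

lemma zero_L: "\<zero>\<^bsub>L\<^esub> = fr \<zero>\<^bsub>M\<^esub> 1"
  by (simp add: localization_def)

end

section \<open>Additive maps between localizations\<close>

definition fraction_map ::
  "('r::comm_ring_1, 'n, 'b) module_scheme \<Rightarrow> 'r set \<Rightarrow> ('r \<Rightarrow> 'm \<Rightarrow> 'n) \<Rightarrow> ('r \<Rightarrow> 'r) \<Rightarrow>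
    ('m \<times> 'r) set \<Rightarrow> ('n \<times> 'r) set" where
  "fraction_map N V h \<sigma> A =
     (\<Union>p\<in>A. case p of (u, s) \<Rightarrow> fraction ring_of_type_algebra N V (h s u) (\<sigma> s))"

text \<open>
  A common form for \<open>u/s \<mapsto> u/s\<close>, \<open>u/s \<mapsto> \<phi>(u)/\<phi>(s)\<close> and \<open>u/s \<mapsto> \<psi>(s\<^sup>m\<^sup>-\<^sup>1 u)/s\<close>: the numerator
  may depend on the chosen denominator.
\<close>

locale localization_map_data =
  dom: localized_module M W + cod: localized_module N V
  for M :: "('r::comm_ring_1, 'm, 'a) module_scheme" and W
    and N :: "('r, 'n, 'b) module_scheme" and V +
  fixes h :: "'r \<Rightarrow> 'm \<Rightarrow> 'n" and \<sigma> :: "'r \<Rightarrow> 'r"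
  assumes h_closed: "s \<in> W \<Longrightarrow> u \<in> carrier M \<Longrightarrow> h s u \<in> carrier N"
    and h_add: "s \<in> W \<Longrightarrow> u \<in> carrier M \<Longrightarrow> v \<in> carrier M \<Longrightarrow> h s (u \<oplus>\<^bsub>M\<^esub> v) = h s u \<oplus>\<^bsub>N\<^esub> h s v"
    and h_smult: "s \<in> W \<Longrightarrow> t \<in> W \<Longrightarrow> u \<in> carrier M \<Longrightarrow> h (t * s) (t \<odot>\<^bsub>M\<^esub> u) = \<sigma> t \<odot>\<^bsub>N\<^esub> h s u"
    and \<sigma>_closed: "s \<in> W \<Longrightarrow> \<sigma> s \<in> V"
    and \<sigma>_mult: "s \<in> W \<Longrightarrow> t \<in> W \<Longrightarrow> \<sigma> (s * t) = \<sigma> s * \<sigma> t"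
begin

text \<open>If w t u = w s v, evaluating \<open>h\<close> at the common denominator w s t on both
  sides gives \<sigma>(w t) h_s(u) = \<sigma>(w s) h_t(v), which is equality of the two images with
  witness \<open>\<sigma> w\<close>.\<close>

lemma fraction_map_fr:
  assumes "u \<in> carrier M" "s \<in> W"
  shows "fraction_map N V h \<sigma> (dom.fr u s) = cod.fr (h s u) (\<sigma> s)"
proof -
  have "cod.fr (h t v) (\<sigma> t) = cod.fr (h s u) (\<sigma> s)"
    if v: "v \<in> carrier M" "t \<in> W" and rel: "dom.frel u s v t" for v t
  proof -
    obtain w where w: "w \<in> W" "(w * t) \<odot>\<^bsub>M\<^esub> u = (w * s) \<odot>\<^bsub>M\<^esub> v"
      using rel by (auto simp: dom.frel_def)
    have "\<sigma> (w * t) \<odot>\<^bsub>N\<^esub> h s u = h ((w * t) * s) ((w * t) \<odot>\<^bsub>M\<^esub> u)"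
      using w v assms by (intro h_smult[symmetric] dom.mult_W)
    also have "\<dots> = h ((w * s) * t) ((w * s) \<odot>\<^bsub>M\<^esub> v)"
      by (simp add: w(2) mult.assoc mult.commute[of s t])
    also have "\<dots> = \<sigma> (w * s) \<odot>\<^bsub>N\<^esub> h t v"
      using w v assms by (intro h_smult dom.mult_W)
    finally show ?thesis
      using w(1) v assms
      by (subst cod.fr_eq_iff) (auto simp: cod.frel_def h_closed \<sigma>_closed \<sigma>_mult intro!: bexI[of _ "\<sigma> w"])
  qed
  then show ?thesis
    using dom.fr_UN[OF assms, of "\<lambda>(u, s). cod.fr (h s u) (\<sigma> s)"]
    by (simp add: fraction_map_def)
qed

lemma fraction_map_closed: "A \<in> carrier dom.L \<Longrightarrow> fraction_map N V h \<sigma> A \<in> carrier cod.L"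
  by (auto simp: dom.carrier_L fraction_map_fr intro!: cod.fr_closed h_closed \<sigma>_closed)

end

context localized_module
begin

lemma add_fr:
  assumes "u \<in> carrier M" "s \<in> W" "v \<in> carrier M" "t \<in> W"
  shows "fr u s \<oplus>\<^bsub>L\<^esub> fr v t = fr (t \<odot>\<^bsub>M\<^esub> u \<oplus>\<^bsub>M\<^esub> s \<odot>\<^bsub>M\<^esub> v) (s * t)"
proof -
  let ?g = "\<lambda>(u, s) (v, t). fr (t \<odot>\<^bsub>M\<^esub> u \<oplus>\<^bsub>M\<^esub> s \<odot>\<^bsub>M\<^esub> v) (s * t)"
  have wd: "fr (t \<odot>\<^bsub>M\<^esub> u \<oplus>\<^bsub>M\<^esub> s \<odot>\<^bsub>M\<^esub> v) (s * t) = fr (t \<odot>\<^bsub>M\<^esub> u' \<oplus>\<^bsub>M\<^esub> s' \<odot>\<^bsub>M\<^esub> v) (s' * t)"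
    if *: "u \<in> carrier M" "s \<in> W" "u' \<in> carrier M" "s' \<in> W" "v \<in> carrier M" "t \<in> W" "frel u s u' s'"
    for u s u' s' v t
  proof -
    obtain w where w: "w \<in> W" "(w * s') \<odot>\<^bsub>M\<^esub> u = (w * s) \<odot>\<^bsub>M\<^esub> u'"
      using * by (auto simp: frel_def)
    have "(w * (s' * t)) \<odot>\<^bsub>M\<^esub> (t \<odot>\<^bsub>M\<^esub> u \<oplus>\<^bsub>M\<^esub> s \<odot>\<^bsub>M\<^esub> v)
      = (t * t) \<odot>\<^bsub>M\<^esub> ((w * s') \<odot>\<^bsub>M\<^esub> u) \<oplus>\<^bsub>M\<^esub> (w * s * s' * t) \<odot>\<^bsub>M\<^esub> v"
      using that by (simp add: smult_add smult_mult mult.commute mult.left_commute)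
    also have "\<dots> = (w * (s * t)) \<odot>\<^bsub>M\<^esub> (t \<odot>\<^bsub>M\<^esub> u' \<oplus>\<^bsub>M\<^esub> s' \<odot>\<^bsub>M\<^esub> v)"
      unfolding w(2) using that by (simp add: smult_add smult_mult mult.commute mult.left_commute)
    finally show ?thesis
      using that w(1) by (subst fr_eq_iff) (auto simp: frel_def mult_W)
  qed
  \<comment> \<open>Commutativity transfers the independence of the left representative to the right
    one.\<close>
  have comm: "fr (t \<odot>\<^bsub>M\<^esub> u \<oplus>\<^bsub>M\<^esub> s \<odot>\<^bsub>M\<^esub> v) (s * t) = fr (s \<odot>\<^bsub>M\<^esub> v \<oplus>\<^bsub>M\<^esub> t \<odot>\<^bsub>M\<^esub> u) (t * s)"
    if "u \<in> carrier M" "v \<in> carrier M" for u v s t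
    using that by (simp add: M.a_comm mult.commute)
  have inner: "(\<Union>q\<in>fr v t. ?g (u', s') q) = ?g (u', s') (v, t)" if "u' \<in> carrier M" "s' \<in> W" for u' s'
  proof (rule fr_UN)
    fix v' t' assume v': "v' \<in> carrier M" "t' \<in> W" "frel v t v' t'"
    show "?g (u', s') (v', t') = ?g (u', s') (v, t)"
      using wd[OF assms(3,4) v'(1,2) that v'(3)] comm[OF that(1) v'(1)] comm[OF that(1) assms(3)]
      by simp
  qed (use assms in auto)
  have "fr u s \<oplus>\<^bsub>L\<^esub> fr v t = (\<Union>p\<in>fr u s. \<Union>q\<in>fr v t. ?g p q)"
    by (simp add: localization_def case_prod_beta)
  also have "\<dots> = (\<Union>q\<in>fr v t. ?g (u, s) q)"
  proof (rule fr_UN[of u s "\<lambda>p. \<Union>q\<in>fr v t. ?g p q"])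
    fix u' s' assume u': "u' \<in> carrier M" "s' \<in> W" "frel u s u' s'"
    show "(\<Union>q\<in>fr v t. ?g (u', s') q) = (\<Union>q\<in>fr v t. ?g (u, s) q)"
      unfolding inner[OF u'(1,2)] inner[OF assms(1,2)]
      using wd[OF assms(1,2) u'(1,2) assms(3,4) u'(3)] by simp
  qed (use assms in auto)
  also have "\<dots> = ?g (u, s) (v, t)" by (rule inner) (use assms in auto)
  finally show ?thesis by simp
qed

lemma abelian_group_L: "abelian_group L"
proof (rule abelian_groupI)
  fix A B assume "A \<in> carrier L" "B \<in> carrier L"
  then obtain u s v t where u: "u \<in> carrier M" "s \<in> W" "A = fr u s"
    and v: "v \<in> carrier M" "t \<in> W" "B = fr v t"
    by (auto simp: carrier_L)
  show "A \<oplus>\<^bsub>L\<^esub> B \<in> carrier L"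
    using u v by (simp add: add_fr fr_closed mult_W)
  show "A \<oplus>\<^bsub>L\<^esub> B = B \<oplus>\<^bsub>L\<^esub> A"
    using u v by (simp add: add_fr M.a_comm mult.commute)
  fix C assume "C \<in> carrier L"
  then obtain x r where x: "x \<in> carrier M" "r \<in> W" "C = fr x r" by (auto simp: carrier_L)
  show "A \<oplus>\<^bsub>L\<^esub> B \<oplus>\<^bsub>L\<^esub> C = A \<oplus>\<^bsub>L\<^esub> (B \<oplus>\<^bsub>L\<^esub> C)"
    using u v x
    by (simp add: add_fr mult_W smult_add smult_mult M.a_assoc mult.commute mult.left_commute mult.assoc)
next
  show "\<zero>\<^bsub>L\<^esub> \<in> carrier L" using one_W by (auto simp: zero_L carrier_L)
next
  fix A assume "A \<in> carrier L"
  then obtain u s where u: "u \<in> carrier M" "s \<in> W" "A = fr u s" by (auto simp: carrier_L)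
  show "\<zero>\<^bsub>L\<^esub> \<oplus>\<^bsub>L\<^esub> A = A"
    using u one_W by (simp add: zero_L add_fr smult_one' smult_r_null[simplified])
  have "fr (\<ominus>\<^bsub>M\<^esub> u) s \<oplus>\<^bsub>L\<^esub> A = fr (s \<odot>\<^bsub>M\<^esub> (\<ominus>\<^bsub>M\<^esub> u \<oplus>\<^bsub>M\<^esub> u)) (s * s)"
    using u by (simp add: add_fr smult_add)
  also have "\<dots> = \<zero>\<^bsub>L\<^esub>"
    unfolding zero_L using u one_W
    by (intro fr_eqI) (simp_all add: mult_W M.l_neg smult_r_null[simplified])
  finally show "\<exists>B\<in>carrier L. B \<oplus>\<^bsub>L\<^esub> A = \<zero>\<^bsub>L\<^esub>"
    using u by (intro bexI[of _ "fr (\<ominus>\<^bsub>M\<^esub> u) s"] fr_closed) auto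
qed

end

lemma (in localization_map_data) abelian_group_hom_fraction_map:
  "abelian_group_hom dom.L cod.L (fraction_map N V h \<sigma>)"
proof (rule abelian_group_homI)
  interpret A: abelian_group dom.L by (rule dom.abelian_group_L)
  interpret B: abelian_group cod.L by (rule cod.abelian_group_L)
  show "group_hom (add_monoid dom.L) (add_monoid cod.L) (fraction_map N V h \<sigma>)"
  proof (intro group_hom.intro A.a_group B.a_group group_hom_axioms.intro homI)
    fix A B assume "A \<in> carrier (add_monoid dom.L)" "B \<in> carrier (add_monoid dom.L)"
    then obtain u s v t where u: "u \<in> carrier M" "s \<in> W" "A = dom.fr u s"
      and v: "v \<in> carrier M" "t \<in> W" "B = dom.fr v t"
      by (auto simp: dom.carrier_L)
    have "h (s * t) (t \<odot>\<^bsub>M\<^esub> u) = \<sigma> t \<odot>\<^bsub>N\<^esub> h s u"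
      using h_smult[of s t u] u v by (simp add: mult.commute)
    then have "fraction_map N V h \<sigma> (A \<oplus>\<^bsub>dom.L\<^esub> B) = fraction_map N V h \<sigma> A \<oplus>\<^bsub>cod.L\<^esub> fraction_map N V h \<sigma> B"
      using u v h_smult[of t s v]
      by (simp add: dom.add_fr cod.add_fr fraction_map_fr dom.mult_W h_closed \<sigma>_closed \<sigma>_mult h_add)
    then show "fraction_map N V h \<sigma> (A \<otimes>\<^bsub>add_monoid dom.L\<^esub> B)
      = fraction_map N V h \<sigma> A \<otimes>\<^bsub>add_monoid cod.L\<^esub> fraction_map N V h \<sigma> B" by simp
  qed (use fraction_map_closed in auto)
qed (rule dom.abelian_group_L cod.abelian_group_L)+

lemma localization_map_eq: "localization_map ring_of_type_algebra M W = fraction_map M W (\<lambda>s u. u) (\<lambda>s. s)"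
  by (simp add: localization_map_def fraction_map_def fun_eq_iff)

lemma (in localized_module) localization_map_data_id:
  assumes "localized_module M V" "W \<subseteq> V"
  shows "localization_map_data M W M V (\<lambda>s u. u) (\<lambda>s. s)"
proof -
  interpret V: localized_module M V by fact
  show ?thesis by unfold_locales (use assms(2) in auto)
qed

lemma abelian_group_hom_closed: "abelian_group_hom G H h \<Longrightarrow> x \<in> carrier G \<Longrightarrow> h x \<in> carrier H"
  using group_hom.hom_closed[OF abelian_group_hom.a_group_hom] by fastforce

lemma hom_finsum:
  assumes "abelian_group_hom G H h" "finite A" "f \<in> A \<rightarrow> carrier G"
  shows "h (\<Oplus>\<^bsub>G\<^esub>x\<in>A. f x) = (\<Oplus>\<^bsub>H\<^esub>x\<in>A. h (f x))"
proof -
  interpret abelian_group_hom G H h by fact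
  show ?thesis
    using assms(2,3)
  proof (induction A rule: finite_induct)
    case (insert x A)
    then have "f \<in> A \<rightarrow> carrier G" "f x \<in> carrier G" "(\<lambda>x. h (f x)) \<in> A \<rightarrow> carrier H"
      by (auto intro!: abelian_group_hom_closed[OF assms(1)])
    with insert show ?case by simp
  qed simp
qed


section \<open>The Cech complex\<close>

lemma localized_module_cech_denoms:
  "module mpoly_ring M \<Longrightarrow> localized_module M (cech_denoms F)"
proof (intro localized_module.intro localized_module_axioms.intro)
  show "1 \<in> cech_denoms F"
    by (auto simp: cech_denoms_def monomial_0[symmetric] intro!: exI[of _ 0])
  fix s t :: "('a, 'b) mpoly" assume "s \<in> cech_denoms F" "t \<in> cech_denoms F"
  then obtain a b where "s = monomial a" "t = monomial b" "Poly_Mapping.keys a \<subseteq> F" "Poly_Mapping.keys b \<subseteq> F"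
    by (auto simp: cech_denoms_def)
  then show "s * t \<in> cech_denoms F"
    using Poly_Mapping.keys_add[of a b] by (auto simp: cech_denoms_def monomial_add[symmetric])
qed

lemma cech_denoms_mono: "F \<subseteq> G \<Longrightarrow> cech_denoms F \<subseteq> cech_denoms G"
  by (auto simp: cech_denoms_def)

lemma abelian_group_cech_local: "module mpoly_ring M \<Longrightarrow> abelian_group (cech_local M F)"
  unfolding cech_local_def
  by (rule localized_module.abelian_group_L[OF localized_module_cech_denoms])

lemma localization_map_cech_hom:
  assumes "module mpoly_ring M" "F \<subseteq> G"
  shows "abelian_group_hom (cech_local M F) (cech_local M G) (localization_map mpoly_ring M (cech_denoms G))"
proof -
  interpret localization_map_data M "cech_denoms F" M "cech_denoms G" "\<lambda>s u. u" "\<lambda>s. s"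
    by (intro localized_module.localization_map_data_id localized_module_cech_denoms cech_denoms_mono assms)
  show ?thesis
    unfolding cech_local_def localization_map_eq by (rule abelian_group_hom_fraction_map)
qed

abbreviation alternate :: "('g, 'b) ring_scheme \<Rightarrow> nat \<Rightarrow> 'g \<Rightarrow> 'g" where
  "alternate G k y \<equiv> (if even k then y else \<ominus>\<^bsub>G\<^esub> y)"

lemma cech_diff_apply:
  "card F = Suc i \<Longrightarrow> cech_diff M i c F =
    (\<Oplus>\<^bsub>cech_local M F\<^esub>x\<in>F. alternate (cech_local M F) (card {z\<in>F. z < x})
      (localization_map mpoly_ring M (cech_denoms F) (c (F - {x}))))"
  by (simp add: cech_diff_def Let_def)

lemma abelian_group_hom_alternate:
  assumes "abelian_group_hom G H h" "x \<in> carrier G"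
  shows "h (alternate G k x) = alternate H k (h x)"
  using abelian_group_hom.hom_a_inv[OF assms] by simp

lemma cech_term_component:
  "c \<in> carrier (cech_term M i) \<Longrightarrow> card F = i \<Longrightarrow> c F \<in> carrier (cech_local M F)"
  by (auto simp: cech_term_def)

lemma group_cech_term: "module mpoly_ring M \<Longrightarrow> group (cech_term M i)"
  unfolding cech_term_def
  by (intro product_group abelian_group.a_group abelian_group_cech_local)

text \<open>It serves two purposes: the coboundaries form a subgroup, and the neutral cochain is a
  cocycle.\<close>

lemma group_hom_cech_diff:
  assumes M: "module mpoly_ring M"
  shows "group_hom (cech_term M i) (cech_term M (Suc i)) (cech_diff M i)"
proof -
  let ?t = "\<lambda>c F x. alternate (cech_local M F) (card {z\<in>F. z < x})
      (localization_map mpoly_ring M (cech_denoms F) (c (F - {x})))"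
  have loc: "localization_map mpoly_ring M (cech_denoms F) (c (F - {x})) \<in> carrier (cech_local M F)"
    if "c \<in> carrier (cech_term M i)" "card F = Suc i" "x \<in> F" for c F x
    using that cech_term_component[of c M i "F - {x}"]
    by (intro abelian_group_hom_closed[OF localization_map_cech_hom[OF M, of "F - {x}" F]]) auto
  have closed: "?t c F x \<in> carrier (cech_local M F)"
    if "c \<in> carrier (cech_term M i)" "card F = Suc i" "x \<in> F" for c F x
    using loc[OF that] abelian_group.a_inv_closed[OF abelian_group_cech_local[OF M]] by simp
  have add: "?t (c \<otimes>\<^bsub>cech_term M i\<^esub> c') F x = ?t c F x \<oplus>\<^bsub>cech_local M F\<^esub> ?t c' F x"
    if c: "c \<in> carrier (cech_term M i)" "c' \<in> carrier (cech_term M i)" and F: "card F = Suc i" "x \<in> F"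
    for c c' F x
  proof -
    interpret abelian_group_hom "cech_local M (F - {x})" "cech_local M F"
      "localization_map mpoly_ring M (cech_denoms F)"
      by (rule localization_map_cech_hom[OF M]) auto
    have "(c \<otimes>\<^bsub>cech_term M i\<^esub> c') (F - {x}) = c (F - {x}) \<oplus>\<^bsub>cech_local M (F - {x})\<^esub> c' (F - {x})"
      using F by (simp add: cech_term_def)
    moreover have "c (F - {x}) \<in> carrier (cech_local M (F - {x}))"
      "c' (F - {x}) \<in> carrier (cech_local M (F - {x}))"
      using c F by (auto intro!: cech_term_component)
    ultimately show ?thesis
      using loc[OF c(1) F] loc[OF c(2) F] by (simp add: H.minus_add)
  qed
  show ?thesis
  proof (intro group_hom.intro group_hom_axioms.intro homI group_cech_term[OF M])
    fix c assume c: "c \<in> carrier (cech_term M i)"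
    have "cech_diff M i c F \<in> carrier (cech_local M F)" if "card F = Suc i" for F
      unfolding cech_diff_apply[OF that] using closed[OF c that]
      by (intro abelian_monoid.finsum_closed abelian_group.axioms(1) abelian_group_cech_local[OF M]) auto
    then show "cech_diff M i c \<in> carrier (cech_term M (Suc i))"
      unfolding cech_term_def carrier_product_group by (auto simp: cech_diff_def)
    fix c' assume c': "c' \<in> carrier (cech_term M i)"
    have "cech_diff M i (c \<otimes>\<^bsub>cech_term M i\<^esub> c') F
      = cech_diff M i c F \<oplus>\<^bsub>cech_local M F\<^esub> cech_diff M i c' F" if F: "card F = Suc i" for F
    proof -
      interpret abelian_group "cech_local M F" by (rule abelian_group_cech_local[OF M])
      have "(\<Oplus>\<^bsub>cech_local M F\<^esub>x\<in>F. ?t (c \<otimes>\<^bsub>cech_term M i\<^esub> c') F x)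
        = (\<Oplus>\<^bsub>cech_local M F\<^esub>x\<in>F. ?t c F x \<oplus>\<^bsub>cech_local M F\<^esub> ?t c' F x)"
        using closed[OF c F] closed[OF c' F] add[OF c c' F] by (intro finsum_cong') auto
      also have "\<dots> = (\<Oplus>\<^bsub>cech_local M F\<^esub>x\<in>F. ?t c F x) \<oplus>\<^bsub>cech_local M F\<^esub> (\<Oplus>\<^bsub>cech_local M F\<^esub>x\<in>F. ?t c' F x)"
        using closed[OF c F] closed[OF c' F] by (intro finsum_addf) auto
      finally show ?thesis unfolding cech_diff_apply[OF F] .
    qed
    then show "cech_diff M i (c \<otimes>\<^bsub>cech_term M i\<^esub> c')
      = cech_diff M i c \<otimes>\<^bsub>cech_term M (Suc i)\<^esub> cech_diff M i c'"
      by (intro ext) (auto simp: cech_term_def cech_diff_def)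
  qed
qed

lemma subgroup_cech_coboundaries:
  assumes M: "module mpoly_ring M"
  shows "subgroup (cech_coboundaries M i) (cech_term M i)"
proof (cases i)
  case 0
  then show ?thesis
    using group.triv_subgroup[OF group_cech_term[OF M]] by (simp add: cech_coboundaries_def)
next
  case (Suc l)
  then show ?thesis
    using group_hom.img_is_subgroup[OF group_hom_cech_diff[OF M]] by (simp add: cech_coboundaries_def)
qed

section \<open>Chain maps between Cech complexes\<close>

locale cech_chain_map =
  fixes M :: "(('x::{finite,linorder}, 'k::field) mpoly, 'm, 'a) module_scheme"
    and N :: "(('x, 'k) mpoly, 'n, 'b) module_scheme"
    and T :: "'x set \<Rightarrow> ('m \<times> ('x, 'k) mpoly) set \<Rightarrow> ('n \<times> ('x, 'k) mpoly) set"
  assumes M: "module mpoly_ring M" and N: "module mpoly_ring N"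
    and T_hom: "abelian_group_hom (cech_local M F) (cech_local N F) (T F)"
    and T_localization_map: "F \<subseteq> G \<Longrightarrow> A \<in> carrier (cech_local M F) \<Longrightarrow>
      T G (localization_map mpoly_ring M (cech_denoms G) A)
        = localization_map mpoly_ring N (cech_denoms G) (T F A)"
begin

definition map_cochain where
  "map_cochain i c = (\<lambda>F\<in>{F. card F = i}. T F (c F))"

lemma map_cochain_closed:
  "c \<in> carrier (cech_term M i) \<Longrightarrow> map_cochain i c \<in> carrier (cech_term N i)"
  using abelian_group_hom_closed[OF T_hom] by (auto simp: cech_term_def map_cochain_def)

lemma map_cochain_one: "map_cochain i \<one>\<^bsub>cech_term M i\<^esub> = \<one>\<^bsub>cech_term N i\<^esub>"
  using group_hom.hom_one[OF abelian_group_hom.a_group_hom[OF T_hom]]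
  by (auto simp: cech_term_def map_cochain_def fun_eq_iff)

text \<open>The differential is an alternating sum of localization maps, and the additive maps
  \<open>T F\<close> commute with these as well as with signs and sums.\<close>

lemma cech_diff_map_cochain:
  assumes c: "c \<in> carrier (cech_term M i)"
  shows "cech_diff N i (map_cochain i c) = map_cochain (Suc i) (cech_diff M i c)"
proof
  fix F
  show "cech_diff N i (map_cochain i c) F = map_cochain (Suc i) (cech_diff M i c) F"
  proof (cases "card F = Suc i")
    case F: True
    let ?t = "\<lambda>x. localization_map mpoly_ring M (cech_denoms F) (c (F - {x}))"
    have cF: "c (F - {x}) \<in> carrier (cech_local M (F - {x}))" if "x \<in> F" for x
      using c F that by (intro cech_term_component) auto
    have t: "?t x \<in> carrier (cech_local M F)" if "x \<in> F" for x
      using cF[OF that] by (intro abelian_group_hom_closed[OF localization_map_cech_hom[OF M, of "F - {x}" F]]) auto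
    have at: "alternate (cech_local M F) k (?t x) \<in> carrier (cech_local M F)" if "x \<in> F" for x k
      using t[OF that] abelian_group.a_inv_closed[OF abelian_group_cech_local[OF M]] by simp
    have eq: "T F (alternate (cech_local M F) (card {z\<in>F. z < x}) (?t x))
      = alternate (cech_local N F) (card {z\<in>F. z < x})
      (localization_map mpoly_ring N (cech_denoms F) (map_cochain i c (F - {x})))" if x: "x \<in> F" for x
    proof -
      have "T F (?t x) = localization_map mpoly_ring N (cech_denoms F) (T (F - {x}) (c (F - {x})))"
        using cF[OF x] by (intro T_localization_map) auto
      also have "T (F - {x}) (c (F - {x})) = map_cochain i c (F - {x})"
        using F x by (simp add: map_cochain_def)
      finally show ?thesis
        unfolding abelian_group_hom_alternate[OF T_hom t[OF x]] by simp
    qed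
    have "T F (cech_diff M i c F)
      = (\<Oplus>\<^bsub>cech_local N F\<^esub>x\<in>F. T F (alternate (cech_local M F) (card {z\<in>F. z < x}) (?t x)))"
      unfolding cech_diff_apply[OF F] using at by (intro hom_finsum[OF T_hom]) auto
    also have "\<dots> = (\<Oplus>\<^bsub>cech_local N F\<^esub>x\<in>F. alternate (cech_local N F) (card {z\<in>F. z < x})
        (localization_map mpoly_ring N (cech_denoms F) (map_cochain i c (F - {x}))))"
    proof (rule abelian_monoid.finsum_cong'[OF abelian_group.axioms(1)[OF abelian_group_cech_local[OF N]] refl])
      show "(\<lambda>x. alternate (cech_local N F) (card {z\<in>F. z < x})
        (localization_map mpoly_ring N (cech_denoms F) (map_cochain i c (F - {x})))) \<in> F \<rightarrow> carrier (cech_local N F)"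
      proof (rule Pi_I)
        fix x assume x: "x \<in> F"
        show "alternate (cech_local N F) (card {z\<in>F. z < x})
          (localization_map mpoly_ring N (cech_denoms F) (map_cochain i c (F - {x}))) \<in> carrier (cech_local N F)"
          using abelian_group_hom_closed[OF T_hom at[OF x, of "card {z\<in>F. z < x}"]] unfolding eq[OF x] .
      qed
    qed (rule eq)
    also have "\<dots> = cech_diff N i (map_cochain i c) F" unfolding cech_diff_apply[OF F] ..
    finally show ?thesis using F by (simp add: map_cochain_def)
  qed (simp add: cech_diff_def map_cochain_def)
qed

lemma map_cochain_cocycle: "c \<in> cech_cocycles M i \<Longrightarrow> map_cochain i c \<in> cech_cocycles N i"
  by (auto simp: cech_cocycles_def kernel_def map_cochain_closed cech_diff_map_cochain map_cochain_one)

lemma map_cochain_coboundary: "c \<in> cech_coboundaries M i \<Longrightarrow> map_cochain i c \<in> cech_coboundaries N i"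
proof (cases i)
  case (Suc l)
  moreover assume "c \<in> cech_coboundaries M i"
  ultimately obtain b where b: "b \<in> carrier (cech_term M l)" "c = cech_diff M l b"
    by (auto simp: cech_coboundaries_def)
  then show ?thesis
    using map_cochain_closed[OF b(1)] cech_diff_map_cochain[OF b(1)] Suc
    by (auto simp: cech_coboundaries_def intro!: image_eqI)
qed (simp add: cech_coboundaries_def map_cochain_one)

end

lemma local_cohomology_one: "\<one>\<^bsub>local_cohomology M i\<^esub> = cech_coboundaries M i"
  by (simp add: local_cohomology_def FactGroup_def)

lemma cech_coboundaries_coset_eq_iff:
  assumes "module mpoly_ring M" "c \<in> cech_cocycles M i"
  shows "cech_coboundaries M i #>\<^bsub>cech_term M i\<^esub> c = cech_coboundaries M i \<longleftrightarrow> c \<in> cech_coboundaries M i"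
  using assms(2) group.coset_join1[OF group_cech_term[OF assms(1)] _ _ subgroup_cech_coboundaries[OF assms(1)]]
    group.coset_join2[OF group_cech_term[OF assms(1)] _ subgroup_cech_coboundaries[OF assms(1)]]
  by (auto simp: cech_cocycles_def kernel_def)

text \<open>The zero class belongs to every degree, so a graded piece differs from the trivial one
  exactly when it contains a further class, that is, the class of a homogeneous cocycle that is not
  a coboundary.\<close>

lemma local_cohomology_graded_nonzero_iff:
  fixes M :: "(('x::{finite,linorder}, 'k::field) mpoly, 'm, 'a) module_scheme"
  assumes M: "module mpoly_ring M" and zero: "\<And>j. \<zero>\<^bsub>M\<^esub> \<in> gM j"
  shows "local_cohomology_graded M gM i j \<noteq> {\<one>\<^bsub>local_cohomology M i\<^esub>} \<longleftrightarrow>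
    (\<exists>c\<in>cech_cocycles M i - cech_coboundaries M i.
      \<forall>F. card F = i \<longrightarrow> c F \<in> localization_graded mpoly_ring poly_graded M gM (cech_denoms F) j)"
proof -
  let ?B = "cech_coboundaries M i"
  let ?deg = "\<lambda>c. \<forall>F. card F = i \<longrightarrow>
    c F \<in> localization_graded mpoly_ring poly_graded M gM (cech_denoms F) j"
  have "?B \<in> local_cohomology_graded M gM i j"
  proof -
    let ?o = "\<one>\<^bsub>cech_term M i\<^esub>"
    have cocycle: "?o \<in> cech_cocycles M i"
      using group_hom.hom_one[OF group_hom_cech_diff[OF M]] group.is_monoid[OF group_cech_term[OF M]]
      by (auto simp: cech_cocycles_def kernel_def monoid.one_closed)
    have "?o F \<in> localization_graded mpoly_ring poly_graded M gM (cech_denoms F) j" if "card F = i" for F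
    proof -
      interpret localized_module M "cech_denoms F" by (rule localized_module_cech_denoms[OF M])
      \<comment> \<open>Each component of the neutral cochain is 0/1, where 1 has degree 0 and 0 has
        every degree.\<close>
      have "(1 :: ('x, 'k) mpoly) \<in> cech_denoms F \<inter> poly_graded 0" using one_W by (simp add: poly_graded_def)
      moreover have "?o F = fraction mpoly_ring M (cech_denoms F) \<zero>\<^bsub>M\<^esub> 1"
        using that by (simp add: cech_term_def cech_local_def zero_L)
      ultimately show ?thesis using zero[of "j + 0"] unfolding localization_graded_def by blast
    qed
    then have "?B #>\<^bsub>cech_term M i\<^esub> ?o \<in> local_cohomology_graded M gM i j"
      using cocycle unfolding local_cohomology_graded_def by blast
    moreover have "?B #>\<^bsub>cech_term M i\<^esub> ?o = ?B"
      using cech_coboundaries_coset_eq_iff[OF M cocycle] subgroup.one_closed[OF subgroup_cech_coboundaries[OF M]]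
      by blast
    ultimately show ?thesis by simp
  qed
  then have "local_cohomology_graded M gM i j \<noteq> {?B} \<longleftrightarrow> (\<exists>A\<in>local_cohomology_graded M gM i j. A \<noteq> ?B)"
    by blast
  also have "\<dots> \<longleftrightarrow> (\<exists>c\<in>cech_cocycles M i. ?deg c \<and> ?B #>\<^bsub>cech_term M i\<^esub> c \<noteq> ?B)"
    unfolding local_cohomology_graded_def by blast
  also have "\<dots> \<longleftrightarrow> (\<exists>c\<in>cech_cocycles M i. ?deg c \<and> c \<notin> ?B)"
    by (intro bex_cong refl) (simp add: cech_coboundaries_coset_eq_iff[OF M])
  finally show ?thesis unfolding local_cohomology_one by blast
qed

section \<open>The splitting on local cohomology\<close>

definition coset_map :: "'a::comm_ring_1 set \<Rightarrow> ('a \<Rightarrow> 'a) \<Rightarrow> 'a set \<Rightarrow> 'a set" where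
  "coset_map J f A = (\<Union>u\<in>A. J +>\<^bsub>ring_of_type_algebra\<^esub> f u)"

lemma coset_map_coset:
  assumes "ideal_set K" "ideal_set J" "\<And>x y. f (x + y) = f x + f y" "f ` K \<subseteq> J"
  shows "coset_map J f (K +>\<^bsub>ring_of_type_algebra\<^esub> u) = J +>\<^bsub>ring_of_type_algebra\<^esub> f u"
proof -
  have "J +>\<^bsub>ring_of_type_algebra\<^esub> f (h + u) = J +>\<^bsub>ring_of_type_algebra\<^esub> f u" if "h \<in> K" for h
    using that assms(4) unfolding coset_eq_iff[OF assms(2)] assms(3) by auto
  then show ?thesis
    using ideal_setD(1)[OF assms(1)] by (auto simp: coset_map_def r_coset_eq_image[of K])
qed

lemma power_map_power: "power_map m (f ^ k) = power_map m f ^ k"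
  by (induction k) (simp_all add: power_map_1 power_map_mult)

lemma cech_denoms_power_map:
  assumes "s \<in> cech_denoms F"
  shows "power_map m s = s ^ m" "power_map m s \<in> cech_denoms F"
proof -
  obtain a where a: "s = monomial a" "Poly_Mapping.keys a \<subseteq> F"
    using assms by (auto simp: cech_denoms_def)
  show "power_map m s = s ^ m" by (simp add: a power_map_monomial)
  have "Poly_Mapping.keys (scale m a) \<subseteq> F" using a(2) by (auto simp: in_keys_iff)
  then show "power_map m s \<in> cech_denoms F"
    by (auto simp: cech_denoms_def a power_map_monomial monomial_power)
qed

lemma power_map_poly_graded: "f \<in> poly_graded j \<Longrightarrow> power_map m f \<in> poly_graded (int m * j)"
proof -
  assume f: "f \<in> poly_graded j"
  have "int (weight UNIV b) = int m * j" if b: "b \<in> Poly_Mapping.keys (power_map m f)" for b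
  proof -
    obtain a where "a \<in> Poly_Mapping.keys f" "b = scale m a"
      using b power_map_keys by blast
    then show ?thesis using f by (auto simp: poly_graded_def weight_scale weight_def[symmetric])
  qed
  then show ?thesis by (simp add: poly_graded_def weight_def)
qed

text \<open>The same \<open>h\<close> and \<open>\<sigma>\<close> serve for all \<open>F\<close>, so
  both ways around the square send u/s to h_s(u)/\<sigma>(s).\<close>

lemma cech_chain_mapI:
  fixes M :: "(('x::{finite,linorder}, 'k::field) mpoly, 'm, 'a) module_scheme"
    and N :: "(('x, 'k) mpoly, 'n, 'b) module_scheme"
  assumes M: "module mpoly_ring M" and N: "module mpoly_ring N"
    and data: "\<And>F. localization_map_data M (cech_denoms F) N (cech_denoms F) h \<sigma>"
  shows "cech_chain_map M N (\<lambda>F. fraction_map N (cech_denoms F) h \<sigma>)"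
proof (rule cech_chain_map.intro[OF M N])
  fix F G :: "'x set" and A
  show "abelian_group_hom (cech_local M F) (cech_local N F) (fraction_map N (cech_denoms F) h \<sigma>)"
    unfolding cech_local_def by (rule localization_map_data.abelian_group_hom_fraction_map[OF data])
  assume FG: "F \<subseteq> G" and A: "A \<in> carrier (cech_local M F)"
  interpret F: localization_map_data M "cech_denoms F" N "cech_denoms F" h \<sigma> by (rule data)
  interpret G: localization_map_data M "cech_denoms G" N "cech_denoms G" h \<sigma> by (rule data)
  interpret MG: localization_map_data M "cech_denoms F" M "cech_denoms G" "\<lambda>s u. u" "\<lambda>s. s"
    using FG by (intro F.dom.localization_map_data_id G.dom.localized_module_axioms cech_denoms_mono)
  interpret NG: localization_map_data N "cech_denoms F" N "cech_denoms G" "\<lambda>s u. u" "\<lambda>s. s"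
    using FG by (intro F.cod.localization_map_data_id G.cod.localized_module_axioms cech_denoms_mono)
  obtain u s where u: "u \<in> carrier M" "s \<in> cech_denoms F" "A = F.dom.fr u s"
    using A by (auto simp: cech_local_def F.dom.carrier_L)
  have "s \<in> cech_denoms G" using u(2) cech_denoms_mono[OF FG] by blast
  then show "fraction_map N (cech_denoms G) h \<sigma> (localization_map mpoly_ring M (cech_denoms G) A)
    = localization_map mpoly_ring N (cech_denoms G) (fraction_map N (cech_denoms F) h \<sigma> A)"
    using u by (simp add: localization_map_eq MG.fraction_map_fr NG.fraction_map_fr
        F.fraction_map_fr G.fraction_map_fr F.h_closed F.\<sigma>_closed)
qed

locale power_splitting =
  fixes J K :: "('x::{finite,linorder}, 'k::field) mpoly set" and m :: nat
  assumes J: "ideal_set J" and K: "ideal_set K" and m: "m > 0"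
    and phi: "power_map m ` K \<subseteq> J" and psi: "root_map m ` J \<subseteq> K"
begin

abbreviation "M \<equiv> quot_module mpoly_ring K"
abbreviation "N \<equiv> quot_module mpoly_ring J"

lemma module_M: "module mpoly_ring M" and module_N: "module mpoly_ring N"
  by (rule module_quot_module[OF K], rule module_quot_module[OF J])

text \<open>A denominator s is a monomial, so \<phi>(s) = s^m and v/s = s^(m-1) v/\<phi>(s). As
  \<psi> is \<phi>-linear, the induced map on fractions must send this to \<psi>(s^(m-1)
  v)/s.\<close>

definition root_numerator where
  "root_numerator s = coset_map K (\<lambda>v. root_map m (s ^ (m - 1) * v))"

abbreviation power_numerator where
  "power_numerator s \<equiv> coset_map J (power_map m)"

lemma power_numerator_coset:
  "coset_map J (power_map m) (K +>\<^bsub>mpoly_ring\<^esub> u) = J +>\<^bsub>mpoly_ring\<^esub> power_map m u"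
  by (rule coset_map_coset[OF K J power_map_add phi])

lemma root_numerator_coset:
  "root_numerator s (J +>\<^bsub>mpoly_ring\<^esub> v) = K +>\<^bsub>mpoly_ring\<^esub> root_map m (s ^ (m - 1) * v)"
  unfolding root_numerator_def
proof (rule coset_map_coset[OF J K])
  show "(\<lambda>v. root_map m (s ^ (m - 1) * v)) ` J \<subseteq> K"
    using psi ideal_setD(3)[OF J] by blast
qed (simp add: distrib_left root_map_add[OF m])

lemma power_map_data:
  "localization_map_data M (cech_denoms F) N (cech_denoms F) power_numerator (power_map m)"
  by (intro localization_map_data.intro localization_map_data_axioms.intro
      localized_module_cech_denoms module_M module_N)
    (auto simp: quot_module_simps[OF K] quot_module_simps[OF J] power_numerator_coset
      power_map_add power_map_mult intro: cech_denoms_power_map(2))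

lemma root_map_data:
  "localization_map_data N (cech_denoms F) M (cech_denoms F) root_numerator (\<lambda>s. s)"
proof (intro localization_map_data.intro localization_map_data_axioms.intro
      localized_module_cech_denoms module_M module_N)
  fix s t :: "('x, 'k) mpoly" and u
  assume t: "t \<in> cech_denoms F" and "u \<in> carrier N"
  then obtain v where v: "u = J +>\<^bsub>mpoly_ring\<^esub> v" by (auto simp: quot_module_simps[OF J])
  \<comment> \<open>The factor t of the numerator completes t^(m-1) to t^m = \<phi>(t), which \<psi>
    releases as t.\<close>
  have "(t * s) ^ (m - 1) * (t * v) = t ^ m * (s ^ (m - 1) * v)"
    using m power_minus_mult[of m t] by (simp add: power_mult_distrib algebra_simps)
  then have "root_map m ((t * s) ^ (m - 1) * (t * v)) = t * root_map m (s ^ (m - 1) * v)"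
    using root_map_power_map_mult[OF m, of t] cech_denoms_power_map(1)[OF t] by metis
  then show "root_numerator (t * s) (t \<odot>\<^bsub>N\<^esub> u) = t \<odot>\<^bsub>M\<^esub> root_numerator s u"
    by (simp add: v quot_module_simps[OF K] quot_module_simps[OF J] root_numerator_coset)
qed (auto simp: quot_module_simps[OF K] quot_module_simps[OF J] root_numerator_coset
    root_map_add[OF m] distrib_left)

sublocale power: cech_chain_map M N "\<lambda>F. fraction_map N (cech_denoms F) power_numerator (power_map m)"
  by (rule cech_chain_mapI[OF module_M module_N power_map_data])

sublocale root: cech_chain_map N M "\<lambda>F. fraction_map M (cech_denoms F) root_numerator (\<lambda>s. s)"
  by (rule cech_chain_mapI[OF module_N module_M root_map_data])

text \<open>On fractions, x/s goes to \<phi>(x)/\<phi>(s) and then to \<psi>(\<phi>(s^(m-1)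
  x))/\<phi>(s) = s^(m-1) x/s^m = x/s.\<close>

lemma root_power_map_cochain:
  assumes c: "c \<in> carrier (cech_term M i)"
  shows "root.map_cochain i (power.map_cochain i c) = c"
proof -
  have "fraction_map M (cech_denoms F) root_numerator (\<lambda>s. s)
      (fraction_map N (cech_denoms F) power_numerator (power_map m) A) = A"
    if A: "A \<in> carrier (cech_local M F)" for F A
  proof -
    interpret P: localization_map_data M "cech_denoms F" N "cech_denoms F" power_numerator "power_map m"
      by (rule power_map_data)
    interpret Q: localization_map_data N "cech_denoms F" M "cech_denoms F" root_numerator "\<lambda>s. s"
      by (rule root_map_data)
    obtain u s where u: "u \<in> carrier M" and s: "s \<in> cech_denoms F" and A: "A = P.dom.fr u s"
      using A by (auto simp: cech_local_def P.dom.carrier_L)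
    obtain x where x: "u = K +>\<^bsub>mpoly_ring\<^esub> x" using u by (auto simp: quot_module_simps[OF K])
    have "root_map m (power_map m s ^ (m - 1) * power_map m x) = s ^ (m - 1) * x"
      using root_map_power_map[OF m, of "s ^ (m - 1) * x"] by (simp add: power_map_mult power_map_power)
    then have "root_numerator (power_map m s) (power_numerator s u) = s ^ (m - 1) \<odot>\<^bsub>M\<^esub> u"
      by (simp add: x power_numerator_coset root_numerator_coset quot_module_simps[OF K])
    moreover have "power_map m s = s ^ (m - 1) * s"
      using cech_denoms_power_map(1)[OF s, of m] power_minus_mult[OF m, of s] by simp
    moreover have "s ^ k \<in> cech_denoms F" for k
      using cech_denoms_power_map[OF s, of k] by simp
    moreover have "fraction_map M (cech_denoms F) root_numerator (\<lambda>s. s)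
        (fraction_map N (cech_denoms F) power_numerator (power_map m) A)
      = P.dom.fr (root_numerator (power_map m s) (power_numerator s u)) (power_map m s)"
      unfolding A P.fraction_map_fr[OF u s]
      by (rule Q.fraction_map_fr[OF P.h_closed[OF s u] P.\<sigma>_closed[OF s]])
    ultimately show ?thesis
      using P.dom.fr_cancel[OF u s, of "s ^ (m - 1)"] by (simp add: A)
  qed
  then show ?thesis
    using c cech_term_component[OF c]
    by (auto simp: root.map_cochain_def power.map_cochain_def fun_eq_iff cech_term_def PiE_def extensional_def)
qed

lemma power_map_cochain_graded:
  assumes "A \<in> localization_graded mpoly_ring poly_graded M (quot_graded K) (cech_denoms F) j"
  shows "fraction_map N (cech_denoms F) power_numerator (power_map m) A
    \<in> localization_graded mpoly_ring poly_graded N (quot_graded J) (cech_denoms F) (int m * j)"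
proof -
  interpret P: localization_map_data M "cech_denoms F" N "cech_denoms F" power_numerator "power_map m"
    by (rule power_map_data)
  obtain f s e where s: "s \<in> cech_denoms F" "s \<in> poly_graded e" and f: "f \<in> poly_graded (j + e)"
    and A: "A = P.dom.fr (K +>\<^bsub>mpoly_ring\<^esub> f) s"
    using assms by (auto simp: localization_graded_def quot_graded_def)
  have "fraction_map N (cech_denoms F) power_numerator (power_map m) A
    = P.cod.fr (J +>\<^bsub>mpoly_ring\<^esub> power_map m f) (power_map m s)"
    unfolding A using s by (subst P.fraction_map_fr) (auto simp: quot_module_simps[OF K] power_numerator_coset)
  moreover have "power_map m s \<in> cech_denoms F \<inter> poly_graded (int m * e)"
    using cech_denoms_power_map[OF s(1)] power_map_poly_graded[OF s(2)] by simp
  moreover have "J +>\<^bsub>mpoly_ring\<^esub> power_map m f \<in> quot_graded J (int m * j + int m * e)"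
    using power_map_poly_graded[OF f, of m] by (auto simp: quot_graded_def distrib_left)
  ultimately show ?thesis unfolding localization_graded_def by blast
qed

text \<open>The retraction detects nonvanishing: were the image of a cocycle a coboundary, applying
  the retraction would exhibit the cocycle itself as one. Degrees are followed only along
  \<phi>.\<close>

lemma local_cohomology_graded_nonzero:
  assumes "local_cohomology_graded M (quot_graded K) i j \<noteq> {\<one>\<^bsub>local_cohomology M i\<^esub>}"
  shows "local_cohomology_graded N (quot_graded J) i (int m * j) \<noteq> {\<one>\<^bsub>local_cohomology N i\<^esub>}"
proof -
  have zero: "\<zero>\<^bsub>quot_module mpoly_ring L\<^esub> \<in> quot_graded L j" if "ideal_set L"
    for L :: "('x, 'k) mpoly set" and j
    by (auto simp: quot_module_simps[OF that] quot_graded_def poly_graded_def)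
  from assms obtain c where "c \<in> cech_cocycles M i - cech_coboundaries M i"
    and deg: "\<forall>F. card F = i \<longrightarrow>
      c F \<in> localization_graded mpoly_ring poly_graded M (quot_graded K) (cech_denoms F) j"
    unfolding local_cohomology_graded_nonzero_iff[OF module_M zero[OF K]] by (rule bexE)
  then have c: "c \<in> cech_cocycles M i" "c \<notin> cech_coboundaries M i" by simp_all
  let ?c = "power.map_cochain i c"
  have "?c \<in> cech_cocycles N i" by (rule power.map_cochain_cocycle[OF c(1)])
  moreover have "?c \<notin> cech_coboundaries N i"
  proof
    assume "?c \<in> cech_coboundaries N i"
    then have "root.map_cochain i ?c \<in> cech_coboundaries M i" by (rule root.map_cochain_coboundary)
    moreover have "c \<in> carrier (cech_term M i)" using c(1) by (simp add: cech_cocycles_def kernel_def)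
    ultimately show False using c(2) root_power_map_cochain by simp
  qed
  moreover have "?c F \<in> localization_graded mpoly_ring poly_graded N (quot_graded J) (cech_denoms F) (int m * j)"
    if "card F = i" for F
    using power_map_cochain_graded[OF deg[rule_format, OF that]] that by (simp add: power.map_cochain_def)
  ultimately show ?thesis
    unfolding local_cohomology_graded_nonzero_iff[OF module_N zero[OF J]]
    by (intro bexI[of _ ?c] allI impI DiffI)
qed

text \<open>Dividing by \<open>m\<close> on the right allows the supremum on the left to be bounded
  degree by degree; vanishing cohomology is included, as the supremum over no degrees is
  -\<infinity>.\<close>

lemma a_invariant_le:
  "ereal (real m) * a_invariant M (quot_graded K) i \<le> a_invariant N (quot_graded J) i"
proof -
  have "ereal (real_of_int j) \<le> a_invariant N (quot_graded J) i / ereal (real m)"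
    if "local_cohomology_graded M (quot_graded K) i j \<noteq> {\<one>\<^bsub>local_cohomology M i\<^esub>}" for j
  proof -
    have "ereal (real_of_int (int m * j)) \<le> a_invariant N (quot_graded J) i"
      unfolding a_invariant_def using local_cohomology_graded_nonzero[OF that] by (intro Sup_upper) blast
    then show ?thesis using m by (simp add: ereal_le_divide_pos)
  qed
  then have "a_invariant M (quot_graded K) i \<le> a_invariant N (quot_graded J) i / ereal (real m)"
    unfolding a_invariant_def[of M] by (intro Sup_least) blast
  then show ?thesis using m by (simp add: ereal_le_divide_pos)
qed

end

text \<open>All that is used about the ceiling: w = 0 shows that l is positive, w = l gives
  \<open>n \<le> m * l\<close> for \<phi>, and arbitrary w gives the inclusion for \<psi>.\<close>

lemma nat_ceiling_divide_le_iff: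
  assumes "m > 0"
  shows "nat \<lceil>real n / real m\<rceil> \<le> w \<longleftrightarrow> n \<le> m * w"
proof -
  have "nat \<lceil>real n / real m\<rceil> \<le> w \<longleftrightarrow> real n \<le> real (m * w)"
    using assms by (simp add: nat_le_iff ceiling_le_iff divide_le_eq mult.commute)
  then show ?thesis by (simp only: of_nat_le_iff)
qed

theorem theorem3p4:
  fixes I :: "('x::{finite,linorder}, 'k::field) mpoly set"
    and n m :: nat
  assumes "squarefree_monomial_ideal I"
    and "n > 0" and "m > 0"
  shows "depth irrelevant_ideal (quot_module mpoly_ring (symbolic_power mpoly_ring I n))
           \<le> depth irrelevant_ideal
               (quot_module mpoly_ring (symbolic_power mpoly_ring I (nat \<lceil>real n / real m\<rceil>))) \<and>
         (\<forall>i::nat. ereal (real i) \<le> krull_dim (mpoly_ring Quot I) \<longrightarrow>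
            a_invariant (quot_module mpoly_ring (symbolic_power mpoly_ring I n))
                (quot_graded (symbolic_power mpoly_ring I n)) i
              \<ge> ereal (real m) *
                a_invariant
                  (quot_module mpoly_ring (symbolic_power mpoly_ring I (nat \<lceil>real n / real m\<rceil>)))
                  (quot_graded (symbolic_power mpoly_ring I (nat \<lceil>real n / real m\<rceil>))) i)"
proof -
  let ?l = "nat \<lceil>real n / real m\<rceil>"
  let ?J = "symbolic_power mpoly_ring I n" and ?K = "symbolic_power mpoly_ring I ?l"
  note le_iff = nat_ceiling_divide_le_iff[OF \<open>m > 0\<close>, of n]
  have "?l > 0" using le_iff[of 0] \<open>n > 0\<close> by simp
  interpret power_splitting ?J ?K m
  proof
    show "power_map m ` ?K \<subseteq> ?J"
      using le_iff[of ?l] by (intro power_map_symbolic_power[OF assms(1)]) simp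
    show "root_map m ` ?J \<subseteq> ?K"
      using le_iff by (intro root_map_symbolic_power[OF assms(1,3)]) simp
  qed (use ideal_set_symbolic_power[OF assms(1)] assms(3) in auto)
  have "depth irrelevant_ideal N \<le> depth irrelevant_ideal M"
    using symbolic_power_subset_irrelevant_ideal[OF assms(1) \<open>?l > 0\<close>]
    by (rule depth_quot_module_le[OF J K m phi psi])
  then show ?thesis using a_invariant_le by blast
qed

end
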